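(* Let $\ell\geq 2$ be an integer and define $g(0,\ell):=0$ and $g(k,\ell):=8(\ell-1)(\lceil\log_2(k\ell)\rceil+1)$ for every integer $k\geq 1$. Then for every multigraph $G$ and every nonnegative integer $k$, either $G$ contains $k$ pairwise edge-disjoint cycles each of length at least $\ell$, or there is a set $F\subseteq E(G)$ of size at most $k\cdot g(k,\ell)$ such that $G-F$ has no cycle of length at least $\ell$.
   Context: Multigraphs are finite and may have parallel edges (so cycles of length 2 may occur). The length of a cycle is its number of edges. $G-F$ denotes $G$ with the edges of $F$ deleted. *)

theory Defs
  imports Complex_Main "HOL-Library.Disjoint_Sets"
begin

text \<open>
  Undirected multigraphs with named edges: \<open>ends G e\<close> is the set of end vertices of \<open>e\<close>, and
  parallel edges are distinct edges with the same ends. An edge with only one end vertex is a loop;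
  loops are permitted, but they form only cycles of length 1.
\<close>

record ('v, 'e) multigraph =
  verts :: "'v set"
  edges :: "'e set"
  ends :: "'e \<Rightarrow> 'v set"

locale fin_multigraph =
  fixes G :: "('v, 'e) multigraph"
  assumes finite_verts: "finite (verts G)"
    and finite_edges: "finite (edges G)"
    and ends_in_verts: "e \<in> edges G \<Longrightarrow> \<exists>u\<in>verts G. \<exists>v\<in>verts G. ends G e = {u, v}"

definition delete_edges :: "('v, 'e) multigraph \<Rightarrow> 'e set \<Rightarrow> ('v, 'e) multigraph" where
  "delete_edges G F = G\<lparr>edges := edges G - F\<rparr>"

text \<open>
  A cycle \<open>v\<^sub>0 e\<^sub>0 v\<^sub>1 e\<^sub>1 \<dots> v\<^sub>n\<^sub>-\<^sub>1 e\<^sub>n\<^sub>-\<^sub>1 v\<^sub>0\<close> is given by the list of its vertices and the list of its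
  edges. Distinctness of the edges matters only for \<open>n = 2\<close>: it excludes traversing a single edge
  back and forth.
\<close>

definition is_cycle :: "('v, 'e) multigraph \<Rightarrow> 'v list \<times> 'e list \<Rightarrow> bool" where
  "is_cycle G C \<longleftrightarrow> (case C of (vs, es) \<Rightarrow>
     es \<noteq> [] \<and> length vs = length es \<and>
     distinct vs \<and> set vs \<subseteq> verts G \<and>
     distinct es \<and> set es \<subseteq> edges G \<and>
     (\<forall>i<length es. ends G (es ! i) = {vs ! i, vs ! (Suc i mod length es)}))"

definition cycle_edges :: "'v list \<times> 'e list \<Rightarrow> 'e set" where
  "cycle_edges C = set (snd C)"

definition cycle_length :: "'v list \<times> 'e list \<Rightarrow> nat" where
  "cycle_length C = length (snd C)"

lemma cycle_length_eq_card:
  "is_cycle G C \<Longrightarrow> cycle_length C = card (cycle_edges C)"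
  by (auto simp: is_cycle_def cycle_length_def cycle_edges_def distinct_card)

definition g :: "nat \<Rightarrow> nat \<Rightarrow> int" where
  "g k l = (if k = 0 then 0 else 8 * (int l - 1) * (\<lceil>log 2 (real k * real l)\<rceil> + 1))"

text \<open>
  A cycle has at least one edge, so edge-disjoint cycles \<open>C i\<close> and \<open>C j\<close> with \<open>i \<noteq> j\<close> are distinct.
\<close>

definition has_disjoint_long_cycles :: "('v, 'e) multigraph \<Rightarrow> nat \<Rightarrow> nat \<Rightarrow> bool" where
  "has_disjoint_long_cycles G k l \<longleftrightarrow>
     (\<exists>C :: nat \<Rightarrow> 'v list \<times> 'e list.
        (\<forall>i<k. is_cycle G (C i) \<and> l \<le> cycle_length (C i)) \<and>
        disjoint_family_on (\<lambda>i. cycle_edges (C i)) {..<k})"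

end

theory Submission
  imports Defs
begin

text \<open>
  It suffices to find few edges whose deletion lowers the maximum number of disjoint long cycles; a
  long cycle of at most \<open>g(k,\<ell>)\<close> edges is such a set. Otherwise there is a gap: every cycle is either
  shorter than \<open>\<ell>\<close> or longer than \<open>g(k,\<ell>)\<close>. Then ``lying on a common short cycle'' is an equivalence
  relation on the edges whose classes, the pieces, contain no long cycle, and two vertices of a piece
  are joined by fewer than \<open>\<ell>\<close> of its edges.

  Consider the bipartite incidence graph between pieces and vertices that lie in several pieces. If it
  has at least \<open>8k\<^sup>2\<close> more edges than vertices, then so does the union of spanning trees of the
  pieces, and a graph of this excess has \<open>k\<close> edge-disjoint cycles, which are long because they
  leave the pieces. Otherwise it has fewer than \<open>16k\<^sup>2\<close> vertices of degree at least 3 and thus a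
  cycle through only logarithmically many of them. Two pieces in series, with two attachments each,
  can be merged into one piece by keeping the bottleneck of the two, so we may assume that this
  cycle visits at most twice as many pieces. Deleting fewer than \<open>\<ell>\<close> edges in each of them lowers the
  packing number: the long cycles that survive can be rerouted inside these pieces so as to leave
  room for one further long cycle, which follows the cycle of the incidence graph.
\<close>

section \<open>Edge sets modulo 2\<close>

text \<open>Cycles are treated as edge sets modulo 2, so rerouting needs no surgery on walks: it
  suffices that each piece keeps its set of odd vertices, because an even edge set whose part in
  some piece is not even contains a long circuit. The obstacle is that a piece with two attachments
  may be crossed by many circuits of a packing. Deleting one join of the attachments leaves room for
  a further one, but a set deleted from only one of two pieces in series joins nothing across both.
  What survives a merge is its effect on the maximum number of disjoint joins, which in series is
  the smaller of the two maxima.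

  On the constants: with \<open>4 * k\<close> \<le> \<open>2 ^ L\<close> the incidence graph has
  fewer than \<open>(4 * k)^2\<close> \<le> \<open>2 ^ (2 * L)\<close> branch vertices and so a
  circuit through at most \<open>4 * L\<close> of them. The circuit found visits at most
  \<open>8 * L\<close> pieces, at a price of at most \<open>l - 1\<close> edges each, and
  \<open>L\<close> is one more than the ceiling of \<open>log 2 (k * l)\<close>. Of the gap only
  this much is used: no circuit has at least \<open>l\<close> and fewer than \<open>2 * l\<close>
  edges.\<close>

definition deg :: "('e \<Rightarrow> 'v set) \<Rightarrow> 'e set \<Rightarrow> 'v \<Rightarrow> nat" where
  "deg f A v = card {e \<in> A. v \<in> f e}"

definition odds :: "('e \<Rightarrow> 'v set) \<Rightarrow> 'e set \<Rightarrow> 'v set" where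
  "odds f A = {v. odd (deg f A v)}"

definition touched :: "('e \<Rightarrow> 'v set) \<Rightarrow> 'e set \<Rightarrow> 'v set" where
  "touched f A = \<Union> (f ` A)"

text \<open>
  Edge sets with exactly two odd vertices take the role of paths. For \<open>x = y\<close> all degrees of \<open>P\<close>
  are even.
\<close>

definition joins :: "('e \<Rightarrow> 'v set) \<Rightarrow> 'e set \<Rightarrow> 'v \<Rightarrow> 'v \<Rightarrow> bool" where
  "joins f P x y \<longleftrightarrow> odds f P = sym_diff {x} {y}"

text \<open>Minimal nonempty members of the cycle space over the two-element field. For loopless
  edges these are exactly the edge sets of cycles of length at least 2, as
  \<open>circuit_list\<close> and \<open>cycle_imp_circuit\<close> make precise.\<close>

definition circuit :: "('e \<Rightarrow> 'v set) \<Rightarrow> 'e set \<Rightarrow> bool" where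
  "circuit f Z \<longleftrightarrow> Z \<noteq> {} \<and> odds f Z = {} \<and> (\<forall>Y\<subseteq>Z. odds f Y = {} \<longrightarrow> Y = {} \<or> Y = Z)"

text \<open>Acyclicity as linear independence of the edges over the two-element field.\<close>

definition forest :: "('e \<Rightarrow> 'v set) \<Rightarrow> 'e set \<Rightarrow> bool" where
  "forest f T \<longleftrightarrow> (\<forall>Y\<subseteq>T. odds f Y = {} \<longrightarrow> Y = {})"

section \<open>Parity calculus of edge sets\<close>

lemma odds_empty [simp]: "odds f {} = {}"
  by (auto simp: odds_def deg_def)

lemma joins_empty [simp]: "joins f {} x x"
  by (auto simp: joins_def)

lemma joins_ne: "x \<noteq> y \<Longrightarrow> joins f P x y \<longleftrightarrow> odds f P = {x, y}"
  by (auto simp: joins_def)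

lemma joins_self: "joins f P x x \<longleftrightarrow> odds f P = {}"
  by (auto simp: joins_def)

lemma joins_sym: "joins f P x y \<Longrightarrow> joins f P y x"
  by (auto simp: joins_def)

lemma joins_empty_iff: "joins f {} x y \<longleftrightarrow> x = y"
  by (cases "x = y") (simp_all add: joins_ne joins_self)

lemma odds_touched: "odds f A \<subseteq> touched f A"
proof
  fix v assume "v \<in> odds f A"
  then have "{e \<in> A. v \<in> f e} \<noteq> {}"
    unfolding odds_def deg_def by (metis (mono_tags) card.empty even_zero mem_Collect_eq)
  then show "v \<in> touched f A" by (auto simp: touched_def)
qed

lemma touched_mono: "A \<subseteq> B \<Longrightarrow> touched f A \<subseteq> touched f B"
  by (auto simp: touched_def)

lemma touched_Un: "touched f (A \<union> B) = touched f A \<union> touched f B"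
  by (auto simp: touched_def)

lemma deg_Un_disjoint:
  assumes "finite A" "finite B" "A \<inter> B = {}"
  shows "deg f (A \<union> B) v = deg f A v + deg f B v"
proof -
  have "{e \<in> A \<union> B. v \<in> f e} = {e \<in> A. v \<in> f e} \<union> {e \<in> B. v \<in> f e}" by auto
  then show ?thesis
    unfolding deg_def using assms by (simp add: card_Un_disjoint disjoint_iff)
qed

lemma deg_Diff:
  assumes "finite A" "B \<subseteq> A"
  shows "deg f A v = deg f (A - B) v + deg f B v"
proof -
  have "A = (A - B) \<union> B" using assms by auto
  then show ?thesis
    using deg_Un_disjoint[of "A - B" B f v] assms finite_subset by fastforce
qed

lemma odds_sym_diff:
  assumes "finite A" "finite B"
  shows "odds f (sym_diff A B) = sym_diff (odds f A) (odds f B)"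
proof -
  have "odd (deg f (sym_diff A B) v) \<longleftrightarrow> odd (deg f A v) \<noteq> odd (deg f B v)" for v
  proof -
    have "deg f (sym_diff A B) v = deg f (A - A \<inter> B) v + deg f (B - A \<inter> B) v"
      using deg_Un_disjoint[of "A - B" "B - A" f v] assms
      by (simp add: Diff_Int Int_Diff Diff_Int_distrib2)
    then show ?thesis
      using deg_Diff[of A "A \<inter> B" f v] deg_Diff[of B "A \<inter> B" f v] assms by auto
  qed
  then show ?thesis by (auto simp: odds_def)
qed

lemma odds_Un_disjoint:
  assumes "finite A" "finite B" "A \<inter> B = {}"
  shows "odds f (A \<union> B) = sym_diff (odds f A) (odds f B)"
  using odds_sym_diff[of A B f] assms by (simp add: Diff_triv Int_commute)

lemma odds_Diff:
  assumes "finite A" "B \<subseteq> A"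
  shows "odds f (A - B) = sym_diff (odds f A) (odds f B)"
proof -
  have "sym_diff A B = A - B" using assms by auto
  then show ?thesis using odds_sym_diff[of A B f] assms finite_subset by fastforce
qed

text \<open>Joins add up modulo 2: shared edges cancel, and so does the common end \<open>y\<close>.
  This replaces concatenating walks and shortcutting them to paths.\<close>

lemma joins_trans:
  assumes "finite P" "finite Q" "joins f P x y" "joins f Q y z"
  shows "joins f (sym_diff P Q) x z"
  using assms unfolding joins_def by (auto simp: odds_sym_diff)

section \<open>Loopless graphs: handshake lemma, reachability, forests and circuits\<close>

locale loopless =
  fixes f :: "'e \<Rightarrow> 'v set" and E :: "'e set"
  assumes fin: "finite E" and ends2: "e \<in> E \<Longrightarrow> card (f e) = 2"
begin

lemma sub: "A \<subseteq> E \<Longrightarrow> loopless f A"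
  by unfold_locales (use fin ends2 finite_subset in auto)

lemma finsub: "A \<subseteq> E \<Longrightarrow> finite A"
  using fin finite_subset by blast

lemma finite_touched: "A \<subseteq> E \<Longrightarrow> finite (touched f A)"
  unfolding touched_def using fin ends2
  by (metis (mono_tags, lifting) card.infinite finite_UN finite_subset subsetD zero_neq_numeral)

lemma finite_odds: "A \<subseteq> E \<Longrightarrow> finite (odds f A)"
  using finite_touched odds_touched finite_subset by metis

lemma other_end:
  assumes "e \<in> E" "y \<in> f e" obtains z where "f e = {y, z}" "z \<noteq> y"
proof -
  obtain a b where "f e = {a, b}" "a \<noteq> b" using ends2[OF assms(1)] by (auto simp: card_2_iff)
  then show thesis using that[of a] that[of b] assms(2) by (auto simp: insert_commute)
qed

lemma deg_edge: "deg f {e} v = (if v \<in> f e then 1 else 0)"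
proof -
  have "{e' \<in> {e}. v \<in> f e'} = (if v \<in> f e then {e} else {})" by auto
  then show ?thesis by (simp add: deg_def)
qed

lemma odds_edge: "odds f {e} = f e"
  by (auto simp: odds_def deg_edge)

lemma joins_edge: "f e = {y, z} \<Longrightarrow> y \<noteq> z \<Longrightarrow> joins f {e} y z"
  by (auto simp: joins_def odds_edge)

lemma deg_pos: "A \<subseteq> E \<Longrightarrow> v \<in> touched f A \<longleftrightarrow> 0 < deg f A v"
  using finite_subset[OF _ fin] by (auto simp: deg_def touched_def card_gt_0_iff)

lemma sum_deg:
  assumes "A \<subseteq> E" "finite V" "touched f A \<subseteq> V"
  shows "(\<Sum>v\<in>V. deg f A v) = 2 * card A"
proof -
  have fA: "finite A" using assms(1) fin finite_subset by blast
  have "(\<Sum>v\<in>V. deg f A v) = (\<Sum>v\<in>V. \<Sum>e\<in>A. if v \<in> f e then 1 else 0)"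
    unfolding deg_def using fA by (simp add: sum.If_cases Int_def)
  also have "\<dots> = (\<Sum>e\<in>A. \<Sum>v\<in>V. if v \<in> f e then 1 else 0)" by (rule sum.swap)
  also have "\<dots> = (\<Sum>e\<in>A. 2)"
  proof (rule sum.cong[OF refl])
    fix e assume e: "e \<in> A"
    then have "V \<inter> {v. v \<in> f e} = f e" using assms(3) by (auto simp: touched_def)
    then show "(\<Sum>v\<in>V. if v \<in> f e then 1 else (0::nat)) = 2"
      using assms e ends2[of e] by (simp add: sum.If_cases subset_iff)
  qed
  finally show ?thesis by simp
qed

lemma handshake:
  assumes "A \<subseteq> E" shows "even (card (odds f A))"
proof -
  have V: "finite (touched f A)" using assms finite_touched by blast
  have "even (\<Sum>v\<in>touched f A. deg f A v)" using sum_deg[OF assms V] by simp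
  then have "even (card {v \<in> touched f A. odd (deg f A v)})"
    using even_sum_iff[OF V, of "deg f A"] by simp
  moreover have "{v \<in> touched f A. odd (deg f A v)} = odds f A"
    using odds_touched[of f A] by (auto simp: odds_def)
  ultimately show ?thesis by simp
qed

text \<open>The number of odd vertices is even, so a single one cannot occur. Arguments at a cut
  vertex reduce to this fact.\<close>

lemma odds_sub_single:
  assumes "A \<subseteq> E" "odds f A \<subseteq> {v}" shows "odds f A = {}"
  using handshake[OF assms(1)] assms(2) by (auto dest: subset_singletonD)

lemma odds_sub_pair:
  assumes "A \<subseteq> E" "odds f A \<subseteq> {u, v}" "odds f A \<noteq> {}" shows "odds f A = {u, v}"
proof (rule ccontr)
  assume "odds f A \<noteq> {u, v}"
  then have "odds f A \<subseteq> {u} \<or> odds f A \<subseteq> {v}" using assms(2) by blast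
  then show False using odds_sub_single assms by metis
qed

text \<open>The edges of \<open>A\<close> avoiding all vertices joined to \<open>x\<close> form a
  union of components. Their only possible odd vertex is \<open>y\<close>, so they are even by the
  handshake lemma, miss \<open>x\<close>, and are none by \<open>min\<close>. The hypothesis
  \<open>min\<close> is phrased to hold both for a forest and for a circuit through
  \<open>x\<close>.\<close>

lemma reach:
  assumes A: "A \<subseteq> E" and od: "odds f A \<subseteq> {x, y}"
    and min: "\<And>Y. Y \<subseteq> A \<Longrightarrow> odds f Y = {} \<Longrightarrow> x \<notin> touched f Y \<Longrightarrow> Y = {}"
    and z: "z \<in> touched f A"
  shows "\<exists>Q\<subseteq>A. joins f Q x z"
proof -
  define R where "R = {r. \<exists>Q\<subseteq>A. joins f Q x r}"
  define S where "S = {e \<in> A. f e \<inter> R = {}}"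
  have fA: "finite A" using A fin finite_subset by blast
  have xR: "x \<in> R" unfolding R_def using joins_empty[of f x] by (auto intro!: exI[of _ "{}"])
  have cl: "f e \<subseteq> R" if e: "e \<in> A" "r \<in> f e" "r \<in> R" for e r
  proof -
    obtain s where s: "f e = {r, s}" "s \<noteq> r" using other_end e A by blast
    obtain Q where Q: "Q \<subseteq> A" "joins f Q x r" using e by (auto simp: R_def)
    have "joins f (sym_diff Q {e}) x s"
      using joins_trans[of Q "{e}"] Q joins_edge s fA finite_subset by (metis finite.emptyI finite.insertI)
    moreover have "sym_diff Q {e} \<subseteq> A" using Q e by auto
    ultimately have "s \<in> R" unfolding R_def by blast
    then show ?thesis using s e by auto
  qed
  have "odds f S \<subseteq> {y}"
  proof
    fix v assume v: "v \<in> odds f S"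
    then have vR: "v \<notin> R" using odds_touched[of f S] by (auto simp: S_def touched_def)
    have "{e \<in> S. v \<in> f e} = {e \<in> A. v \<in> f e}" using cl vR unfolding S_def by blast
    then have "v \<in> odds f A" using v by (simp add: odds_def deg_def)
    then show "v \<in> {y}" using od xR vR by auto
  qed
  then have "odds f S = {}" using odds_sub_single A S_def by (metis (no_types, lifting) mem_Collect_eq subset_iff)
  moreover have "x \<notin> touched f S" using xR by (auto simp: S_def touched_def)
  ultimately have "S = {}" using min[of S] by (auto simp: S_def)
  then have "z \<in> R" using z cl by (fastforce simp: S_def touched_def)
  then show ?thesis by (auto simp: R_def)
qed

lemma forest_unique:
  assumes "T \<subseteq> E" "forest f T" "P \<subseteq> T" "Q \<subseteq> T" "joins f P x y" "joins f Q x y"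
  shows "P = Q"
proof -
  have fPQ: "finite P" "finite Q" using assms fin by (meson finite_subset)+
  have "odds f (sym_diff P Q) = {}" using odds_sym_diff[OF fPQ, of f] assms(5,6) by (simp add: joins_def)
  moreover have "sym_diff P Q \<subseteq> T" using assms by auto
  ultimately have "sym_diff P Q = {}" using assms(2) unfolding forest_def by metis
  then show ?thesis by auto
qed

lemma forest_mono: "forest f T \<Longrightarrow> S \<subseteq> T \<Longrightarrow> forest f S"
  by (auto simp: forest_def)

text \<open>After deleting one of several edges at \<open>y\<close>, the rest would still reach
  \<open>y\<close> from \<open>x\<close>. This would give a second join from \<open>x\<close> to
  \<open>y\<close>, against uniqueness in a forest.\<close>

lemma forest_deg_one:
  assumes Q: "Q \<subseteq> E" "forest f Q" "joins f Q x y" and "x \<noteq> y"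
  shows "deg f Q y = 1"
proof (rule ccontr)
  assume n1: "deg f Q y \<noteq> 1"
  have fQ: "finite Q" using Q fin finite_subset by blast
  have "odd (deg f Q y)" using assms by (auto simp: joins_ne odds_def)
  then have "0 < deg f Q y" by (simp add: odd_pos)
  then obtain e where e: "e \<in> Q" "y \<in> f e" using deg_pos[OF Q(1)] by (auto simp: touched_def)
  obtain a where a: "f e = {y, a}" "a \<noteq> y" using other_end e Q by blast
  have d: "Q - {e} = sym_diff Q {e}" using e by auto
  have "joins f (sym_diff Q {e}) x a"
    by (rule joins_trans[OF fQ _ Q(3) joins_edge]) (use a in auto)
  then have J: "joins f (Q - {e}) x a" by (simp only: d[symmetric])
  then have od: "odds f (Q - {e}) \<subseteq> {x, a}" by (auto simp: joins_def)
  have "deg f Q y = deg f (Q - {e}) y + 1"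
    using deg_Diff[OF fQ, of "{e}" f y] e by (simp add: deg_edge)
  then have "y \<in> touched f (Q - {e})" using deg_pos[of "Q - {e}"] n1 \<open>0 < deg f Q y\<close> Q by auto
  moreover have "forest f (Q - {e})" using Q(2) forest_mono by blast
  ultimately obtain Q1 where Q1: "Q1 \<subseteq> Q - {e}" "joins f Q1 x y"
    using reach[of "Q - {e}" x a y] Q od unfolding forest_def by (meson Diff_subset order_trans)
  then have "Q1 = Q" using forest_unique[OF Q(1,2) _ _ Q1(2) Q(3)] by blast
  then show False using Q1 e by blast
qed

lemma circuit_minus_edge:
  assumes "circuit f Z" "e \<in> Z" shows "forest f (Z - {e})"
  using assms unfolding circuit_def forest_def by blast

text \<open>Deleting an edge at \<open>y\<close> leaves a forest that joins the ends of this edge,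
  and \<open>y\<close> has degree 1 there.\<close>

lemma circuit_deg_two:
  assumes Z: "Z \<subseteq> E" "circuit f Z" and y: "y \<in> touched f Z"
  shows "deg f Z y = 2"
proof -
  obtain e where e: "e \<in> Z" "y \<in> f e" using y by (auto simp: touched_def)
  obtain x where x: "f e = {y, x}" "x \<noteq> y" using other_end e Z by blast
  have fZ: "finite Z" using Z finsub by blast
  have "odds f (Z - {e}) = {x, y}"
    using odds_Diff[OF fZ, of "{e}" f] e x Z by (auto simp: circuit_def odds_edge)
  then have "deg f (Z - {e}) y = 1"
    using forest_deg_one[of "Z - {e}" x y] circuit_minus_edge[OF Z(2) e(1)] Z x by (auto simp: joins_ne)
  then show ?thesis using deg_Diff[OF fZ, of "{e}" f y] e by (simp add: deg_edge)
qed

lemma circuit_card: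
  assumes Z: "Z \<subseteq> E" "circuit f Z" shows "card (touched f Z) = card Z"
proof -
  have "2 * card Z = (\<Sum>v\<in>touched f Z. deg f Z v)" using sum_deg[of Z "touched f Z"] Z finite_touched by simp
  also have "\<dots> = (\<Sum>v\<in>touched f Z. 2)" using circuit_deg_two[OF Z] by (intro sum.cong) auto
  finally show ?thesis by simp
qed

lemma circuit_join:
  assumes Z: "Z \<subseteq> E" "circuit f Z" and xy: "x \<in> touched f Z" "y \<in> touched f Z"
  shows "\<exists>Q\<subseteq>Z. joins f Q x y"
proof (rule reach[where x = x and y = x, OF Z(1) _ _ xy(2)])
  show "odds f Z \<subseteq> {x, x}" using Z by (simp add: circuit_def)
  show "Y = {}" if "Y \<subseteq> Z" "odds f Y = {}" "x \<notin> touched f Y" for Y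
    using Z(2) that xy(1) unfolding circuit_def by metis
qed

lemma circuit_in_even:
  assumes W: "W \<subseteq> E" "odds f W = {}" and e: "e \<in> W"
  shows "\<exists>C\<subseteq>W. e \<in> C \<and> circuit f C"
proof -
  have "\<exists>C. (C \<subseteq> W \<and> odds f C = {} \<and> e \<in> C) \<and> (\<forall>Y. (Y \<subseteq> W \<and> odds f Y = {} \<and> e \<in> Y) \<longrightarrow> card C \<le> card Y)"
    by (rule ex_has_least_nat[of _ W]) (simp add: W e)
  then obtain C where C: "C \<subseteq> W" "odds f C = {}" "e \<in> C"
    and min: "\<And>Y. Y \<subseteq> W \<Longrightarrow> odds f Y = {} \<Longrightarrow> e \<in> Y \<Longrightarrow> card C \<le> card Y"
    by (elim exE conjE) metis
  have fC: "finite C" using C(1) W(1) finsub by (meson order_trans)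
  have "Y = {} \<or> Y = C" if Y: "Y \<subseteq> C" "odds f Y = {}" for Y
  proof (rule ccontr)
    assume n: "\<not> (Y = {} \<or> Y = C)"
    show False
    proof (cases "e \<in> Y")
      case True
      have "card Y < card C" using n Y fC by (meson psubsetI psubset_card_mono)
      then show False using min[of Y] Y C True by auto
    next
      case False
      have "odds f (C - Y) = {}" using odds_Diff[OF fC Y(1), of f] Y C by simp
      moreover have "card (C - Y) < card C" using n Y fC by (intro psubset_card_mono) auto
      ultimately show False using min[of "C - Y"] C False by auto
    qed
  qed
  then show ?thesis using C unfolding circuit_def by blast
qed

section \<open>Short even sets under minimum degree three\<close>

lemma short_even_unique:
  assumes noev: "\<And>Z. Z \<subseteq> E \<Longrightarrow> Z \<noteq> {} \<Longrightarrow> odds f Z = {} \<Longrightarrow> n < card Z"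
    and P: "P \<subseteq> E" "joins f P x y" and Q: "Q \<subseteq> E" "joins f Q x y" and le: "card P + card Q \<le> n"
  shows "P = Q"
proof (rule ccontr)
  assume "P \<noteq> Q"
  have fPQ: "finite P" "finite Q" using P Q finsub by auto
  have "odds f (sym_diff P Q) = {}" using odds_sym_diff[OF fPQ, of f] P Q by (simp add: joins_def)
  moreover have "sym_diff P Q \<subseteq> E" using P Q by auto
  moreover have "sym_diff P Q \<noteq> {}" using \<open>P \<noteq> Q\<close> by auto
  ultimately have "n < card (sym_diff P Q)" using noev by metis
  also have "\<dots> \<le> card (P \<union> Q)" using fPQ by (intro card_mono) auto
  also have "\<dots> \<le> n" using le card_Un_le[of P Q] by linarith
  finally show False by simp
qed

text \<open>The doubling of spheres behind the Moore bound. Joins with at most \<open>i\<close>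
  edges are determined by their ends, because two different ones would differ by an even set of at
  most \<open>2 * i\<close> edges. A join with \<open>j\<close> edges uses at most one of the three
  or more edges at its end, so it extends in at least two ways, and different extensions end in
  different vertices.\<close>

lemma sphere_growth:
  assumes noev: "\<And>Z. Z \<subseteq> E \<Longrightarrow> Z \<noteq> {} \<Longrightarrow> odds f Z = {} \<Longrightarrow> 2 * i < card Z"
    and d3: "\<And>v. v \<in> touched f E \<Longrightarrow> 3 \<le> deg f E v" and v: "v \<in> touched f E"
  shows "j \<le> i \<Longrightarrow> 2 ^ j \<le> card {y \<in> touched f E. \<exists>P\<subseteq>E. joins f P v y \<and> card P = j}"
proof (induction j)
  case 0
  have "{y \<in> touched f E. \<exists>P\<subseteq>E. joins f P v y \<and> card P = 0} = {v}"
  proof (intro set_eqI iffI)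
    fix y assume "y \<in> {y \<in> touched f E. \<exists>P\<subseteq>E. joins f P v y \<and> card P = 0}"
    then obtain P where "P \<subseteq> E" "joins f P v y" "card P = 0" by blast
    then have "joins f {} v y" using fin by (metis card_0_eq finite_subset)
    then show "y \<in> {v}" by (simp add: joins_empty_iff)
  next
    fix y assume "y \<in> {v}"
    then show "y \<in> {y \<in> touched f E. \<exists>P\<subseteq>E. joins f P v y \<and> card P = 0}"
      using v joins_empty[of f v] by (auto intro!: exI[of _ "{}"])
  qed
  then show ?case by simp
next
  case (Suc j)
  define S where "S j = {y \<in> touched f E. \<exists>P\<subseteq>E. joins f P v y \<and> card P = j}" for j
  have finS: "finite (S j)" for j using finite_touched[of E] by (simp add: S_def)
  have "\<exists>P. \<forall>y\<in>S j. P y \<subseteq> E \<and> joins f (P y) v y \<and> card (P y) = j"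
    by (rule bchoice) (auto simp: S_def)
  then obtain P where P: "\<And>y. y \<in> S j \<Longrightarrow> P y \<subseteq> E \<and> joins f (P y) v y \<and> card (P y) = j" by blast
  have uniq: "Q = R" if "Q \<subseteq> E" "joins f Q x y" "R \<subseteq> E" "joins f R x y" "card Q + card R \<le> 2 * i" for Q R x y
    by (rule short_even_unique[where n = "2 * i", OF _ that]) (rule noev)
  have ftree: "forest f Q" if "Q \<subseteq> E" "card Q \<le> Suc j" for Q
    unfolding forest_def
  proof (intro allI impI)
    fix Y assume Y: "Y \<subseteq> Q" "odds f Y = {}"
    have "card Y \<le> card Q" using Y that fin by (meson card_mono finite_subset)
    then show "Y = {}" using noev[of Y] Y that Suc.prems by fastforce
  qed
  define N where "N y = {e \<in> E. y \<in> f e \<and> e \<notin> P y}" for y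
  have N2: "2 \<le> card (N y)" if y: "y \<in> S j" for y
  proof -
    have "deg f (P y) y \<le> 1"
    proof (cases "y = v")
      case True
      have "P y = {}"
      proof (rule uniq)
        show "P y \<subseteq> E" "joins f (P y) v v" using P[OF y] True by auto
        show "card (P y) + card ({}::'e set) \<le> 2 * i" using P[OF y] Suc.prems by simp
      qed simp_all
      then show ?thesis by (simp add: deg_def)
    next
      case False
      then show ?thesis using forest_deg_one[of "P y" v y] P[OF y] ftree[of "P y"] by simp
    qed
    moreover have "deg f E y = deg f (E - P y) y + deg f (P y) y" using deg_Diff[OF fin, of "P y" f y] P[OF y] by simp
    moreover have "deg f (E - P y) y = card (N y)" unfolding deg_def N_def by (rule arg_cong[of _ _ card]) auto
    moreover have "3 \<le> deg f E y" using d3 y by (simp add: S_def)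
    ultimately show ?thesis by linarith
  qed
  define h where "h = (\<lambda>(y, e). the_elem (f e - {y}))"
  have h: "\<exists>z. f e = {y, z} \<and> z \<noteq> y \<and> h (y, e) = z \<and> z \<in> S (Suc j) \<and> z \<noteq> v \<and> insert e (P y) \<subseteq> E \<and>
      joins f (insert e (P y)) v z \<and> card (insert e (P y)) = Suc j"
    if y: "y \<in> S j" and e: "e \<in> N y" for y e
  proof -
    obtain z where z: "f e = {y, z}" "z \<noteq> y" using other_end[of e y] e by (auto simp: N_def)
    have fP: "finite (P y)" using P[OF y] finsub by blast
    have s: "sym_diff (P y) {e} = insert e (P y)" using e by (auto simp: N_def)
    have "joins f {e} y z" using z joins_edge by metis
    then have J: "joins f (insert e (P y)) v z" using joins_trans[OF fP, of "{e}"] P[OF y] s by fastforce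
    have sub: "insert e (P y) \<subseteq> E" using P[OF y] e by (auto simp: N_def)
    have c: "card (insert e (P y)) = Suc j" using P[OF y] e fP by (simp add: N_def)
    have "z \<noteq> v"
    proof
      assume "z = v"
      have "insert e (P y) = {}"
      proof (rule uniq[OF sub])
        show "joins f (insert e (P y)) v v" using J \<open>z = v\<close> by simp
        show "card (insert e (P y)) + card ({}::'e set) \<le> 2 * i" using c Suc.prems by simp
      qed simp_all
      then show False by simp
    qed
    moreover have "z \<in> touched f E" using z e by (auto simp: N_def touched_def)
    moreover have "f e - {y} = {z}" using z by auto
    moreover have "\<exists>P\<subseteq>E. joins f P v z \<and> card P = Suc j" using J sub c by blast
    ultimately show ?thesis using z J sub c by (simp add: h_def S_def)
  qed
  have "2 * card (S j) = (\<Sum>y\<in>S j. 2)" by simp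
  also have "\<dots> \<le> (\<Sum>y\<in>S j. card (N y))" using N2 by (intro sum_mono) auto
  also have "\<dots> = card (Sigma (S j) N)" using finS fin by (simp add: N_def)
  also have "\<dots> \<le> card (S (Suc j))"
  proof (rule card_inj_on_le[of h])
    show "h ` Sigma (S j) N \<subseteq> S (Suc j)" using h by fastforce
    show "inj_on h (Sigma (S j) N)"
    proof (rule inj_onI, clarify)
      fix y e y' e' assume A: "y \<in> S j" "e \<in> N y" "y' \<in> S j" "e' \<in> N y'" "h (y, e) = h (y', e')"
      obtain z where z: "f e = {y, z}" "z \<noteq> y" "h (y, e) = z" "z \<noteq> v" "insert e (P y) \<subseteq> E"
        "joins f (insert e (P y)) v z" "card (insert e (P y)) = Suc j" using h[OF A(1,2)] by blast
      obtain z' where z': "f e' = {y', z'}" "z' \<noteq> y'" "h (y', e') = z'" "insert e' (P y') \<subseteq> E"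
        "joins f (insert e' (P y')) v z'" "card (insert e' (P y')) = Suc j" using h[OF A(3,4)] by blast
      have zz: "z' = z" using A z z' by simp
      have eq: "insert e (P y) = insert e' (P y')"
      proof (rule uniq[OF z(5,6) z'(4)])
        show "joins f (insert e' (P y')) v z" using z' zz by simp
        show "card (insert e (P y)) + card (insert e' (P y')) \<le> 2 * i" using z(7) z'(6) Suc.prems by simp
      qed
      \<comment> \<open>Both extensions are the same set, and its only edge at \<open>z\<close> is
        the last one; this recovers \<open>e\<close> and then \<open>y\<close>.\<close>
      have "deg f (insert e (P y)) z = 1"
        using forest_deg_one[OF z(5) ftree z(6)] z by simp
      then obtain a where a: "{d \<in> insert e (P y). z \<in> f d} = {a}" unfolding deg_def One_nat_def card_1_singleton_iff by blast
      have "e \<in> {d \<in> insert e (P y). z \<in> f d}" using z by simp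
      moreover have "e' \<in> {d \<in> insert e (P y). z \<in> f d}" using z' zz eq by simp
      ultimately have "e = e'" unfolding a by simp
      then show "y = y' \<and> e = e'" using z z' zz by (auto simp: doubleton_eq_iff)
    qed
    show "finite (S (Suc j))" using finS .
  qed
  finally show ?case using Suc by (simp add: S_def)
qed

lemma min_degree_three:
  assumes "E \<noteq> {}" and d3: "\<And>v. v \<in> touched f E \<Longrightarrow> 3 \<le> deg f E v" and "card (touched f E) < 2 ^ i"
  shows "\<exists>Z\<subseteq>E. Z \<noteq> {} \<and> odds f Z = {} \<and> card Z \<le> 2 * i"
proof (rule ccontr)
  assume n: "\<not> ?thesis"
  obtain v where v: "v \<in> touched f E"
    using assms(1) ends2 by (metis UN_iff all_not_in_conv card.empty touched_def zero_neq_numeral)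
  have "2 ^ i \<le> card {y \<in> touched f E. \<exists>P\<subseteq>E. joins f P v y \<and> card P = i}"
    using n sphere_growth[where i = i and j = i, OF _ d3 v] by (metis (no_types, lifting) not_le order_refl)
  also have "\<dots> \<le> card (touched f E)" using finite_touched by (intro card_mono) auto
  finally show False using assms(3) by simp
qed

end

section \<open>Graphs with few branch vertices\<close>

lemma deg_insert:
  assumes "finite A" "e \<notin> A"
  shows "deg f (insert e A) v = deg f A v + (if v \<in> f e then 1 else 0)"
proof -
  have "{d \<in> insert e A. v \<in> f d} = {d \<in> A. v \<in> f d} \<union> (if v \<in> f e then {e} else {})" by auto
  then show ?thesis using assms by (simp add: deg_def)
qed

lemma deg_cong: "(\<And>e. e \<in> A \<Longrightarrow> f e = f' e) \<Longrightarrow> deg f A v = deg f' A v"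
  unfolding deg_def by (metis (mono_tags, lifting) Collect_cong)

text \<open>
  Suppressing a vertex \<open>x\<close> of degree 2 with edges \<open>e\<^sub>1 = xa\<close> and \<open>e\<^sub>2 = xb\<close> keeps \<open>e\<^sub>1\<close> as the edge
  \<open>ab\<close>; here \<open>Z\<close> is an edge set of the new graph.
\<close>

lemma deg_suppress:
  assumes fin: "finite Z" and Z: "e2 \<notin> Z" "\<And>e. e \<in> Z \<Longrightarrow> e \<noteq> e1 \<Longrightarrow> x \<notin> f e"
    and e: "f e1 = {x, a}" "f e2 = {x, b}" "a \<noteq> b" "a \<noteq> x" "b \<noteq> x" "e1 \<noteq> e2"
  shows "deg f (if e1 \<in> Z then insert e2 Z else Z) v =
    (if v = x then if e1 \<in> Z then 2 else 0 else deg (f(e1 := {a, b})) Z v)"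
proof (cases "e1 \<in> Z")
  case True
  define W where "W = Z - {e1}"
  have W: "Z = insert e1 W" "e1 \<notin> W" "e2 \<notin> insert e1 W" "finite W" using True Z fin e by (auto simp: W_def)
  have "{e \<in> W. x \<in> f e} = {}" using Z by (auto simp: W_def)
  then have "deg f W x = 0" unfolding deg_def by (simp only: card.empty)
  moreover have "deg (f(e1 := {a, b})) W v = deg f W v" by (rule deg_cong) (use W in auto)
  ultimately show ?thesis using W e by (auto simp: deg_insert)
next
  case False
  then have "{e \<in> Z. x \<in> f e} = {}" using Z by auto
  then have "deg f Z x = 0" unfolding deg_def by (simp only: card.empty)
  moreover have "deg (f(e1 := {a, b})) Z v = deg f Z v" by (rule deg_cong) (use False in auto)
  ultimately show ?thesis using False by auto
qed

text \<open>Suppressing a vertex of degree 2 changes neither the branch vertices nor their degrees,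
  and an even set of the smaller graph lifts back to one through the same branch vertices. When no
  vertex of degree 2 is left, sphere growth gives a short circuit, which has as many vertices as
  edges.\<close>

lemma few_branch_even:
  assumes "loopless f E" "E \<noteq> {}" "\<And>v. v \<in> touched f E \<Longrightarrow> 2 \<le> deg f E v"
    and "card {v \<in> touched f E. 3 \<le> deg f E v} < 2 ^ i"
  shows "\<exists>Z\<subseteq>E. Z \<noteq> {} \<and> odds f Z = {} \<and> card {v \<in> touched f Z. 3 \<le> deg f E v} \<le> 2 * i"
  using assms
proof (induction "card E" arbitrary: f E rule: less_induct)
  case less
  interpret loopless f E by (rule less.prems)
  show ?case
  proof (cases "\<forall>v\<in>touched f E. 3 \<le> deg f E v")
    case True
    then have "{v \<in> touched f E. 3 \<le> deg f E v} = touched f E" by auto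
    then obtain Z where Z: "Z \<subseteq> E" "Z \<noteq> {}" "odds f Z = {}" "card Z \<le> 2 * i"
      using min_degree_three[of i] less.prems True by auto
    obtain C where C: "C \<subseteq> Z" "circuit f C" using circuit_in_even[OF Z(1,3)] Z(2) by blast
    have "card {v \<in> touched f C. 3 \<le> deg f E v} \<le> card (touched f C)"
      using finite_touched[of C] C Z by (intro card_mono) auto
    also have "\<dots> = card C" using circuit_card[of C] C Z by auto
    also have "\<dots> \<le> 2 * i" using Z C card_mono[OF finsub[OF Z(1)] C(1)] by linarith
    finally show ?thesis using C Z unfolding circuit_def by (intro exI[of _ C]) auto
  next
    case False
    then obtain x where x: "x \<in> touched f E" "deg f E x = 2" using less.prems(3) by fastforce
    obtain e1 e2 where e12: "{e \<in> E. x \<in> f e} = {e1, e2}" "e1 \<noteq> e2"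
      using x(2) unfolding deg_def card_2_iff by blast
    have eE: "e1 \<in> E" "x \<in> f e1" "e2 \<in> E" "x \<in> f e2" using e12 by auto
    obtain a where a: "f e1 = {x, a}" "a \<noteq> x" using other_end eE by metis
    obtain b where b: "f e2 = {x, b}" "b \<noteq> x" using other_end eE by metis
    have other: "x \<notin> f e" if "e \<in> E" "e \<noteq> e1" "e \<noteq> e2" for e using e12 that by blast
    show ?thesis
    \<comment> \<open>If both edges at \<open>x\<close> lead to the same vertex, suppression would
      create a loop; but then the two edges already form an even set with at most one branch
      vertex.\<close>
    proof (cases "a = b")
      case True
      have "odds f {e1, e2} = {}"
        using odds_Un_disjoint[of "{e1}" "{e2}" f] e12(2) a b True by (simp add: odds_edge insert_commute)
      moreover have "card {v \<in> touched f {e1, e2}. 3 \<le> deg f E v} \<le> 2 * i"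
      proof (cases "3 \<le> deg f E a")
        case True
        have "a \<in> touched f E" using a eE by (auto simp: touched_def)
        then have "{v \<in> touched f E. 3 \<le> deg f E v} \<noteq> {}" using True by auto
        then have "0 < card {v \<in> touched f E. 3 \<le> deg f E v}" using finite_touched[of E] by (simp add: card_gt_0_iff)
        \<comment> \<open>With \<open>i = 0\<close> there would be no branch vertex, but
          \<open>a\<close> is one.\<close>
        then have "i \<noteq> 0" using less.prems(4) by (metis less_one not_gr0 power_0)
        moreover have "{v \<in> touched f {e1, e2}. 3 \<le> deg f E v} \<subseteq> {a}"
          using a b \<open>a = b\<close> x by (auto simp: touched_def)
        then have "card {v \<in> touched f {e1, e2}. 3 \<le> deg f E v} \<le> card {a}" by (intro card_mono) auto
        ultimately show ?thesis by simp
      next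
        case False
        then have "{v \<in> touched f {e1, e2}. 3 \<le> deg f E v} = {}"
          using a b \<open>a = b\<close> x by (auto simp: touched_def)
        then show ?thesis by (simp only: card.empty)
      qed
      ultimately show ?thesis using eE by (intro exI[of _ "{e1, e2}"]) auto
    next
      case False
      define f' where "f' = f(e1 := {a, b})"
      define E' where "E' = E - {e2}"
      define lift where "lift Z = (if e1 \<in> Z then insert e2 Z else Z)" for Z
      have L: "deg f (lift Z) v = (if v = x then if e1 \<in> Z then 2 else 0 else deg f' Z v)" if "Z \<subseteq> E'" for Z v
        unfolding lift_def f'_def
        by (rule deg_suppress) (use that a b False e12(2) other finsub[of Z] in \<open>auto simp: E'_def\<close>)
      have LE: "lift E' = E" using eE e12(2) by (auto simp: lift_def E'_def)
      have e1: "e1 \<in> E'" using eE e12 by (simp add: E'_def)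
      have ll: "loopless f' E'"
        using fin ends2 False by unfold_locales (auto simp: E'_def f'_def)
      interpret S: loopless f' E' by (rule ll)
      have dg: "deg f E v = deg f' E' v" if "v \<noteq> x" for v using L[of E' v] LE that by simp
      have xt: "x \<notin> touched f' Z" if "Z \<subseteq> E'" for Z
        using that other False a b by (auto simp: touched_def f'_def E'_def)
      have tch: "touched f' E' = touched f E - {x}"
      proof (intro set_eqI iffI)
        fix v assume v: "v \<in> touched f' E'"
        then have vx: "v \<noteq> x" using xt[of E'] by auto
        show "v \<in> touched f E - {x}"
          using v vx deg_pos[of E v] S.deg_pos[of E' v] dg[OF vx] by auto
      next
        fix v assume v: "v \<in> touched f E - {x}"
        then show "v \<in> touched f' E'"
          using deg_pos[of E v] S.deg_pos[of E' v] dg[of v] by auto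
      qed
      have br: "{v \<in> touched f' E'. 3 \<le> deg f' E' v} = {v \<in> touched f E. 3 \<le> deg f E v}"
      proof (intro set_eqI)
        fix v show "v \<in> {v \<in> touched f' E'. 3 \<le> deg f' E' v} \<longleftrightarrow> v \<in> {v \<in> touched f E. 3 \<le> deg f E v}"
          using tch dg[of v] x(2) by (cases "v = x") auto
      qed
      have "card E' < card E" using fin eE unfolding E'_def by (intro psubset_card_mono) auto
      moreover have "2 \<le> deg f' E' v" if "v \<in> touched f' E'" for v
        using that tch dg[of v] less.prems(3)[of v] by auto
      ultimately obtain Z where Z: "Z \<subseteq> E'" "Z \<noteq> {}" "odds f' Z = {}"
        "card {v \<in> touched f' Z. 3 \<le> deg f' E' v} \<le> 2 * i"
        using less.hyps[OF _ ll] e1 br less.prems(4) by auto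
      have LZ: "lift Z \<subseteq> E" using Z eE by (auto simp: lift_def E'_def)
      have "odds f (lift Z) = {}" using L[OF Z(1)] Z(3) by (auto simp: odds_def)
      moreover have "{v \<in> touched f (lift Z). 3 \<le> deg f E v} \<subseteq> {v \<in> touched f' Z. 3 \<le> deg f' E' v}"
      proof clarify
        fix v assume v: "v \<in> touched f (lift Z)" "3 \<le> deg f E v"
        then have vx: "v \<noteq> x" using x by auto
        then show "v \<in> touched f' Z \<and> 3 \<le> deg f' E' v"
          using v dg[OF vx] deg_pos[OF LZ, of v] S.deg_pos[OF Z(1), of v] L[OF Z(1), of v] by auto
      qed
      then have "card {v \<in> touched f (lift Z). 3 \<le> deg f E v} \<le> card {v \<in> touched f' Z. 3 \<le> deg f' E' v}"
        by (rule card_mono[rotated]) (simp add: S.finite_touched[OF Z(1)])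
      then have "card {v \<in> touched f (lift Z). 3 \<le> deg f E v} \<le> 2 * i" using Z(4) by linarith
      moreover have "lift Z \<noteq> {}" using Z(2) by (auto simp: lift_def)
      ultimately show ?thesis using LZ by blast
    qed
  qed
qed

text \<open>The degrees minus 2 add up to twice the excess of edges over vertices, and every branch
  vertex contributes at least 1.\<close>

lemma excess_branch:
  assumes "loopless f E" "\<And>v. v \<in> touched f E \<Longrightarrow> 2 \<le> deg f E v" "card E \<le> card (touched f E) + m"
  shows "card {v \<in> touched f E. 3 \<le> deg f E v} \<le> 2 * m"
proof -
  interpret loopless f E by fact
  let ?V = "touched f E"
  have fV: "finite ?V" using finite_touched by simp
  have "2 * card ?V + card {v \<in> ?V. 3 \<le> deg f E v} = (\<Sum>v\<in>?V. 2 + (if 3 \<le> deg f E v then 1 else 0))"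
  proof -
    have "(\<Sum>v\<in>?V. if 3 \<le> deg f E v then 1 else 0) = card {v \<in> ?V. 3 \<le> deg f E v}"
      using fV by (simp add: sum.If_cases Int_def)
    then show ?thesis by (simp only: sum.distrib sum_constant mult.commute of_nat_id)
  qed
  also have "\<dots> \<le> (\<Sum>v\<in>?V. deg f E v)" using assms(2) by (intro sum_mono) (force simp: numeral_2_eq_2)
  also have "\<dots> = 2 * card E" using sum_deg[of E ?V] fV by simp
  finally show ?thesis using assms(3) by linarith
qed

section \<open>Edge-disjoint circuits from a quadratic excess of edges\<close>

lemma branch_bound: "0 < k \<Longrightarrow> 16 * (Suc k)\<^sup>2 < (2::nat) ^ (8 * k + 4)"
proof -
  assume k: "0 < k"
  have "Suc k \<le> 2 ^ k" by (rule Suc_leI) (rule less_exp)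
  then have "(Suc k)\<^sup>2 \<le> (2 ^ k)\<^sup>2" by (rule power_mono) simp
  also have "(2 ^ k)\<^sup>2 = (2::nat) ^ (2 * k)" by (simp add: power_mult mult.commute)
  also have "\<dots> < 2 ^ (8 * k)" using k by (intro power_strict_increasing) auto
  finally show ?thesis by (simp add: power_add)
qed

text \<open>In a smallest edge set with excess \<open>M\<close> all degrees are at least 2 and few
  exceed 2. A circuit through at most \<open>2 * i\<close> branch vertices can be removed cheaply:
  its vertices of degree 2 vanish together with its edges, so the excess drops by at most
  \<open>2 * i\<close>. These losses, linear in \<open>k\<close>, add up to the quadratic
  requirement.\<close>

lemma excess_packing:
  assumes "loopless f E" "card (touched f E) + 8 * k\<^sup>2 \<le> card E"
  shows "\<exists>C::nat \<Rightarrow> 'e set. (\<forall>i<k. C i \<subseteq> E \<and> circuit f (C i)) \<and> disjoint_family_on C {..<k}"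
  using assms
proof (induction k arbitrary: E)
  case 0
  then show ?case by (auto simp: disjoint_family_on_def)
next
  case (Suc k)
  define M where "M = 8 * (Suc k)\<^sup>2"
  have "\<exists>A. (A \<subseteq> E \<and> card (touched f A) + M \<le> card A) \<and>
      (\<forall>B. (B \<subseteq> E \<and> card (touched f B) + M \<le> card B) \<longrightarrow> card A \<le> card B)"
    by (rule ex_has_least_nat[of _ E]) (use Suc.prems in \<open>simp add: M_def\<close>)
  then obtain A where A: "A \<subseteq> E" "card (touched f A) + M \<le> card A"
    and min: "\<And>B. B \<subseteq> E \<Longrightarrow> card (touched f B) + M \<le> card B \<Longrightarrow> card A \<le> card B"
    by (elim exE conjE) metis
  interpret loopless f A using loopless.sub[OF Suc.prems(1) A(1)] .
  let ?V = "touched f A"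
  have fV: "finite ?V" using finite_touched by simp
  have step: "card A \<le> card (touched f (A - {e})) + M" if e: "e \<in> A" for e
  proof (rule ccontr)
    assume "\<not> ?thesis"
    then have "card (touched f (A - {e})) + M \<le> card (A - {e})" using e fin by (simp add: card_Diff_singleton)
    then have "card A \<le> card (A - {e})" using min[of "A - {e}"] A by blast
    then show False using e fin by (metis card_Diff1_less not_le)
  qed
  have "A \<noteq> {}" using A by (auto simp: M_def)
  then obtain e where e: "e \<in> A" by blast
  have "card (touched f (A - {e})) \<le> card ?V" using fV touched_mono[of "A - {e}" A f] by (intro card_mono) auto
  then have eq: "card A = card ?V + M" using step[OF e] A by linarith
  have d2: "2 \<le> deg f A v" if v: "v \<in> ?V" for v
  proof (rule ccontr)
    assume "\<not> ?thesis"
    then have "deg f A v = 1" using deg_pos[of A v] v by auto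
    then obtain d where d: "{d \<in> A. v \<in> f d} = {d}" unfolding deg_def One_nat_def card_1_singleton_iff by blast
    then have dA: "d \<in> A" by auto
    have "touched f (A - {d}) \<subseteq> ?V - {v}" using d by (auto simp: touched_def)
    then have "card (touched f (A - {d})) \<le> card (?V - {v})" using fV by (intro card_mono) auto
    also have "\<dots> < card ?V" using v fV by (intro card_Diff1_less)
    finally show False using step[OF dA] eq by linarith
  qed
  have br: "card {v \<in> ?V. 3 \<le> deg f A v} \<le> 2 * M"
    by (rule excess_branch[OF loopless_axioms]) (use d2 eq in auto)
  \<comment> \<open>For positive \<open>k\<close> this spends the whole budget:
    \<open>2 * i = 16 * k + 8\<close> is the difference of \<open>8 * (Suc k)^2\<close> and
    \<open>8 * k^2\<close>. For \<open>k = 0\<close> the value 4 would just miss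
    \<open>16 < 2 ^ i\<close>; as nothing has to remain after this circuit, 5 is affordable.\<close>
  define i where "i = (if k = 0 then 5 else 8 * k + 4)"
  have "2 * M < 2 ^ i" using branch_bound[of k] by (auto simp: i_def M_def)
  then obtain Z0 where Z0: "Z0 \<subseteq> A" "Z0 \<noteq> {}" "odds f Z0 = {}" "card {v \<in> touched f Z0. 3 \<le> deg f A v} \<le> 2 * i"
    using few_branch_even[OF loopless_axioms \<open>A \<noteq> {}\<close>, of i] d2 br by (meson le_less_trans)
  obtain Z where Z: "Z \<subseteq> Z0" "circuit f Z" using circuit_in_even[OF Z0(1,3)] Z0(2) by blast
  have ZA: "Z \<subseteq> A" using Z Z0 by blast
  have fZ: "finite (touched f Z)" using finite_touched[OF ZA] .
  have b2: "card {v \<in> touched f Z. 3 \<le> deg f A v} \<le> 2 * i"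
  proof -
    have "card {v \<in> touched f Z. 3 \<le> deg f A v} \<le> card {v \<in> touched f Z0. 3 \<le> deg f A v}"
      by (rule card_mono) (use finite_touched[OF Z0(1)] touched_mono[OF Z(1), of f] in auto)
    then show ?thesis using Z0(4) by linarith
  qed
  have "\<exists>C::nat \<Rightarrow> 'e set. (\<forall>i<k. C i \<subseteq> A - Z \<and> circuit f (C i)) \<and> disjoint_family_on C {..<k}"
  proof (cases "k = 0")
    case True
    then show ?thesis by (auto simp: disjoint_family_on_def)
  next
    case False
    \<comment> \<open>Vertices of \<open>Z\<close> with degree 2 in \<open>A\<close>: both of their
      edges lie in \<open>Z\<close>, so \<open>A - Z\<close> loses them.\<close>
    let ?D = "{v \<in> touched f Z. \<not> 3 \<le> deg f A v}"
    have "touched f (A - Z) \<subseteq> ?V - ?D"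
    proof
      fix v assume v: "v \<in> touched f (A - Z)"
      have "deg f A v = deg f (A - Z) v + deg f Z v" using deg_Diff[OF fin ZA] .
      moreover have "0 < deg f (A - Z) v" using v deg_pos[of "A - Z" v] by auto
      ultimately have "v \<notin> ?D" using circuit_deg_two[OF ZA Z(2), of v] by auto
      then show "v \<in> ?V - ?D" using v touched_mono[of "A - Z" A f] by auto
    qed
    then have "card (touched f (A - Z)) \<le> card (?V - ?D)" using fV by (intro card_mono) auto
    also have "\<dots> = card ?V - card ?D" using touched_mono[OF ZA, of f] fZ by (intro card_Diff_subset) auto
    finally have 1: "card (touched f (A - Z)) \<le> card ?V - card ?D" .
    have 2: "card ?D \<le> card ?V" using touched_mono[OF ZA, of f] fV by (intro card_mono) auto
    have "card (touched f Z) = card {v \<in> touched f Z. 3 \<le> deg f A v} + card ?D"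
      using fZ by (subst card_Un_disjoint[symmetric]) (auto intro!: arg_cong[of _ _ card])
    then have 3: "card Z \<le> 2 * i + card ?D" using b2 circuit_card[OF ZA Z(2)] by linarith
    have 4: "card (A - Z) = card A - card Z" "card Z \<le> card A"
      using fin ZA finsub by (auto intro!: card_Diff_subset card_mono)
    have 5: "2 * i + 8 * k\<^sup>2 \<le> M" using False by (simp add: i_def M_def power2_eq_square)
    have "card (touched f (A - Z)) + 8 * k\<^sup>2 \<le> card (A - Z)" using 1 2 3 4 5 eq by linarith
    then show ?thesis using Suc.IH[of "A - Z"] sub[of "A - Z"] by auto
  qed
  then obtain C where C: "\<And>i. i < k \<Longrightarrow> C i \<subseteq> A - Z \<and> circuit f (C i)" "disjoint_family_on C {..<k}" by blast
  have "disjoint_family_on (C(k := Z)) {..<Suc k}"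
    using C unfolding disjoint_family_on_def by (auto simp: less_Suc_eq) blast+
  moreover have "\<forall>i<Suc k. (C(k := Z)) i \<subseteq> E \<and> circuit f ((C(k := Z)) i)"
  proof (intro allI impI)
    fix i assume "i < Suc k"
    then show "(C(k := Z)) i \<subseteq> E \<and> circuit f ((C(k := Z)) i)"
      using C(1)[of i] Z(2) ZA A(1) by (cases "i = k") auto
  qed
  ultimately show ?case by blast
qed

section \<open>Spanning trees and cycles\<close>

context loopless
begin

text \<open>A smallest connecting subset \<open>T\<close> is a forest, since any edge of a nonempty
  even subset can be bypassed by adding that subset modulo 2. For the count, each vertex other than
  a root \<open>r\<close> is sent to the last edge of its join from \<open>r\<close>. If
  \<open>y\<close> and \<open>z\<close> shared that edge, the join to \<open>z\<close> would be the
  join to \<open>y\<close> without it, yet contain it.\<close>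

lemma spanning_tree:
  assumes B: "B \<subseteq> E" "B \<noteq> {}"
    and conn: "\<And>u v. u \<in> touched f B \<Longrightarrow> v \<in> touched f B \<Longrightarrow> \<exists>Q\<subseteq>B. joins f Q u v"
  shows "\<exists>T\<subseteq>B. forest f T \<and> touched f T = touched f B \<and> card (touched f B) \<le> card T + 1"
proof -
  define ok where "ok T \<longleftrightarrow> T \<subseteq> B \<and> (\<forall>u\<in>touched f B. \<forall>v\<in>touched f B. \<exists>Q\<subseteq>T. joins f Q u v)" for T
  have "\<exists>T. ok T \<and> (\<forall>S. ok S \<longrightarrow> card T \<le> card S)"
    by (rule ex_has_least_nat[of _ B]) (simp add: ok_def conn)
  then obtain T where T: "ok T" and min: "\<And>S. ok S \<Longrightarrow> card T \<le> card S" by blast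
  have TB: "T \<subseteq> B" and TE: "T \<subseteq> E" using T B by (auto simp: ok_def)
  have fT: "finite T" using TE finsub by blast
  have forest: "forest f T"
    unfolding forest_def
  proof (intro allI impI, rule ccontr)
    fix Y assume Y: "Y \<subseteq> T" "odds f Y = {}" "Y \<noteq> {}"
    then obtain e where e: "e \<in> Y" by blast
    have "\<exists>Q\<subseteq>T - {e}. joins f Q u v" if uv: "u \<in> touched f B" "v \<in> touched f B" for u v
    proof -
      obtain Q where Q: "Q \<subseteq> T" "joins f Q u v" using T uv unfolding ok_def by blast
      show ?thesis
      proof (cases "e \<in> Q")
        case True
        have "joins f (sym_diff Q Y) u v"
        proof (rule joins_trans[OF _ _ Q(2)])
          show "joins f Y v v" using Y by (simp add: joins_self)
          show "finite Q" "finite Y" using Q(1) Y(1) fT by (meson finite_subset)+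
        qed
        moreover have "sym_diff Q Y \<subseteq> T - {e}" using Q Y e True by auto
        ultimately show ?thesis by blast
      next
        case False
        then show ?thesis using Q by blast
      qed
    qed
    then have "ok (T - {e})" using TB by (auto simp: ok_def)
    then have "card T \<le> card (T - {e})" by (rule min)
    then show False using e Y fT by (metis card_Diff1_less not_le subsetD)
  qed
  have tch: "touched f T = touched f B"
  proof
    show "touched f T \<subseteq> touched f B" using TB by (rule touched_mono)
    show "touched f B \<subseteq> touched f T"
    proof
      fix u assume u: "u \<in> touched f B"
      then obtain e where e: "e \<in> B" "u \<in> f e" by (auto simp: touched_def)
      obtain w where w: "f e = {u, w}" "w \<noteq> u" using other_end e B by blast
      have "w \<in> touched f B" using e w by (auto simp: touched_def)
      then obtain Q where Q: "Q \<subseteq> T" "joins f Q u w" using T u unfolding ok_def by blast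
      then have "u \<in> odds f Q" using w by (auto simp: joins_ne)
      then show "u \<in> touched f T" using odds_touched[of f Q] touched_mono[OF Q(1), of f] by blast
    qed
  qed
  obtain r where r: "r \<in> touched f B"
    using B ends2 by (metis UN_iff all_not_in_conv card.empty subsetD touched_def zero_neq_numeral)
  have "\<forall>y\<in>touched f B - {r}. \<exists>J. J \<subseteq> T \<and> joins f J r y"
    using T r unfolding ok_def by blast
  from bchoice[OF this] obtain J where J0: "\<forall>y\<in>touched f B - {r}. J y \<subseteq> T \<and> joins f (J y) r y" ..
  define h where "h y = the_elem {d \<in> J y. y \<in> f d}" for y
  have J: "J y \<subseteq> T \<and> joins f (J y) r y \<and> {d \<in> J y. y \<in> f d} = {h y}" if y: "y \<in> touched f B - {r}" for y
  proof -
    have "J y \<subseteq> T" and j: "joins f (J y) r y" using J0 y by auto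
    moreover have "deg f (J y) y = 1"
      using forest_deg_one[OF _ _ j] TE forest_mono[OF forest] y J0 by (metis DiffD2 insertI1 order_trans)
    then obtain e where "{d \<in> J y. y \<in> f d} = {e}" unfolding deg_def One_nat_def card_1_singleton_iff by blast
    ultimately show ?thesis by (simp add: h_def)
  qed
  have h: "h y \<in> T \<and> y \<in> f (h y)" if y: "y \<in> touched f B - {r}" for y
    using J[OF y] by blast
  have "card (touched f B - {r}) \<le> card T"
  proof (rule card_inj_on_le[of h])
    show "h ` (touched f B - {r}) \<subseteq> T" using h by blast
    show "inj_on h (touched f B - {r})"
    proof (rule inj_onI, rule ccontr)
      fix y z assume A: "y \<in> touched f B - {r}" "z \<in> touched f B - {r}" "h y = h z" "y \<noteq> z"
      have hT: "h y \<in> T" using h A by blast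
      have e: "f (h y) = {y, z}"
        using other_end[of "h y" y] h[OF A(1)] h[OF A(2)] A(3,4) TE by (metis empty_iff insert_iff subsetD)
      have hJ: "h y \<in> J y" "h y \<in> J z" using J[OF A(1)] J[OF A(2)] A(3) by auto
      have s: "J y - {h y} = sym_diff (J y) {h y}" using hJ by auto
      have "joins f (sym_diff (J y) {h y}) r z"
        by (rule joins_trans[OF _ _ _ joins_edge[OF e A(4)]]) (use J[OF A(1)] fT in \<open>auto intro: finite_subset\<close>)
      then have "joins f (J y - {h y}) r z" by (simp only: s[symmetric])
      then have "J y - {h y} = J z"
        using forest_unique[OF TE forest, of "J y - {h y}" "J z" r z] J[OF A(1)] J[OF A(2)] by blast
      then show False using hJ by blast
    qed
  qed (rule fT)
  moreover have "card (touched f B - {r}) = card (touched f B) - 1" using r by simp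
  ultimately show ?thesis using TB forest tch by (intro exI[of _ T]) auto
qed

text \<open>The passage from joins to genuine paths: the end \<open>y\<close> has exactly one edge,
  which is peeled off as the last step.\<close>

lemma forest_path:
  assumes "Q \<subseteq> E" "forest f Q" "joins f Q x y" "x \<noteq> y"
  shows "\<exists>vs es. length vs = Suc (length es) \<and> vs ! 0 = x \<and> last vs = y \<and> distinct vs \<and> distinct es \<and>
    set es = Q \<and> set vs = touched f Q \<and> (\<forall>i<length es. f (es ! i) = {vs ! i, vs ! Suc i})"
  using assms
proof (induction "card Q" arbitrary: Q y)
  case 0
  then have "Q = {}" using finsub by auto
  then show ?case using 0 by (simp add: joins_empty_iff)
next
  case (Suc n)
  have fQ: "finite Q" using Suc.prems(1) finsub by blast
  have d1: "deg f Q y = 1" using forest_deg_one Suc.prems by blast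
  then obtain e where "{d \<in> Q. y \<in> f d} = {e}" unfolding deg_def One_nat_def card_1_singleton_iff by blast
  then have e: "e \<in> Q" "y \<in> f e" by auto
  obtain a where a: "f e = {a, y}" "a \<noteq> y" using other_end e Suc.prems(1) by (metis insert_commute subsetD)
  define R where "R = Q - {e}"
  have R: "R \<subseteq> E" "forest f R" "R \<subseteq> Q" "Q = insert e R" "e \<notin> R"
    using Suc.prems e forest_mono[of Q R] by (auto simp: R_def)
  have s: "R = sym_diff Q {e}" using e by (auto simp: R_def)
  have "joins f (sym_diff Q {e}) x a"
  proof (rule joins_trans[OF fQ _ Suc.prems(3)])
    show "joins f {e} y a" using a joins_edge[of e y a] by (simp add: insert_commute)
  qed simp
  then have J: "joins f R x a" by (simp only: s[symmetric])
  have "deg f R y = 0" using d1 deg_Diff[OF fQ, of "{e}" f y] e by (simp add: deg_edge R_def)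
  then have yR: "y \<notin> touched f R" using deg_pos[OF R(1)] by simp
  have tQ: "touched f Q = touched f R \<union> {a, y}" using a R by (auto simp: touched_def)
  show ?case
  proof (cases "x = a")
    case True
    then have "R = {}" using R(2) J unfolding forest_def by (auto simp: joins_self)
    then show ?thesis using a True R tQ by (intro exI[of _ "[a, y]"] exI[of _ "[e]"]) (auto simp: touched_def)
  next
    case False
    have "n = card R" using Suc.hyps(2) fQ e by (simp add: R_def)
    then obtain vs es where I: "length vs = Suc (length es)" "vs ! 0 = x" "last vs = a" "distinct vs" "distinct es"
      "set es = R" "set vs = touched f R" "\<forall>i<length es. f (es ! i) = {vs ! i, vs ! Suc i}"
      using Suc.hyps(1)[of R a] R J False by blast
    have vn: "vs \<noteq> []" using I(1) by auto
    have "vs ! length es = a" using I(1,3) vn by (simp add: last_conv_nth)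
    then have "\<forall>i<length (es @ [e]). f ((es @ [e]) ! i) = {(vs @ [y]) ! i, (vs @ [y]) ! Suc i}"
      using I(1,8) a(1) by (auto simp: nth_append less_Suc_eq)
    moreover have "a \<in> touched f R" using I(3,7) vn by (metis last_in_set)
    ultimately show ?thesis
      using I vn yR tQ R by (intro exI[of _ "vs @ [y]"] exI[of _ "es @ [e]"]) (auto simp: nth_append)
  qed
qed

text \<open>A circuit minus an edge is a forest joining the ends of this edge, which closes the
  resulting path.\<close>

lemma circuit_list:
  assumes Z: "Z \<subseteq> E" "circuit f Z"
  shows "\<exists>vs es. es \<noteq> [] \<and> length vs = length es \<and> distinct vs \<and> set vs = touched f Z \<and> distinct es \<and>
    set es = Z \<and> (\<forall>i<length es. f (es ! i) = {vs ! i, vs ! (Suc i mod length es)})"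
proof -
  obtain e where e: "e \<in> Z" using Z(2) by (auto simp: circuit_def)
  obtain x y where xy: "f e = {x, y}" "x \<noteq> y" using ends2[of e] e Z by (auto simp: card_2_iff)
  have fZ: "finite Z" using Z finsub by blast
  have "odds f (Z - {e}) = {x, y}"
    using odds_Diff[OF fZ, of "{e}" f] e xy Z by (simp add: circuit_def odds_edge)
  then have "joins f (Z - {e}) x y" using xy by (simp add: joins_ne)
  then obtain vs es where I: "length vs = Suc (length es)" "vs ! 0 = x" "last vs = y" "distinct vs" "distinct es"
      "set es = Z - {e}" "set vs = touched f (Z - {e})" "\<forall>i<length es. f (es ! i) = {vs ! i, vs ! Suc i}"
    using forest_path[of "Z - {e}" x y] circuit_minus_edge[OF Z(2) e] Z xy by blast
  have vn: "vs \<noteq> []" using I(1) by auto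
  have "vs ! length es = y" using I(1,3) vn by (simp add: last_conv_nth)
  then have "\<forall>i<length (es @ [e]). f ((es @ [e]) ! i) = {vs ! i, vs ! (Suc i mod length (es @ [e]))}"
    using I(2,8) xy(1) by (auto simp: nth_append less_Suc_eq insert_commute mod_Suc)
  moreover have "x \<in> set vs" "y \<in> set vs" using I vn by (metis length_greater_0_conv nth_mem, metis last_in_set)
  then have "set vs = touched f Z" using I(7) xy e by (auto simp: touched_def)
  ultimately show ?thesis using I e by (intro exI[of _ vs] exI[of _ "es @ [e]"]) auto
qed

end

text \<open>Of the two edges at a vertex of the cycle, an even subset contains both or neither,
  hence it contains all edges of the cycle or none. Length at least 2 excludes loops.\<close>

lemma cycle_imp_circuit:
  assumes C: "is_cycle G C" "2 \<le> cycle_length C"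
  shows "circuit (ends G) (cycle_edges C)" "\<And>e. e \<in> cycle_edges C \<Longrightarrow> card (ends G e) = 2"
proof -
  obtain vs es where vses: "C = (vs, es)" by force
  define n where "n = length es"
  define f where "f = ends G"
  have n: "2 \<le> n" using C vses by (simp add: n_def cycle_length_def)
  have I: "length vs = n" "distinct vs" "distinct es" "\<And>i. i < n \<Longrightarrow> f (es ! i) = {vs ! i, vs ! (Suc i mod n)}"
    using C vses by (auto simp: is_cycle_def n_def f_def)
  have ce: "cycle_edges C = set es" using vses by (simp add: cycle_edges_def)
  have suc: "Suc i mod n < n" "Suc i mod n \<noteq> i" if "i < n" for i
    using that n by (auto simp: mod_Suc)
  have sinj: "i = j" if "i < n" "j < n" "Suc i mod n = Suc j mod n" for i j
    using that n by (auto simp: mod_Suc split: if_splits)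
  have vinj: "i = j" if "i < n" "j < n" "vs ! i = vs ! j" for i j
    using that I by (simp add: nth_eq_iff_index_eq)
  show "card (ends G e) = 2" if e: "e \<in> cycle_edges C" for e
  proof -
    obtain i where i: "i < n" "e = es ! i" using e unfolding ce n_def by (metis in_set_conv_nth)
    have "vs ! i \<noteq> vs ! (Suc i mod n)" using vinj[of i "Suc i mod n"] suc[OF i(1)] i(1) by auto
    then show ?thesis using I(4)[OF i(1)] i by (simp add: f_def)
  qed
  \<comment> \<open>The vertex is written as the successor of \<open>j\<close>, so that its two
    edges are number \<open>j\<close> and number \<open>Suc j mod n\<close> and no predecessor
    modulo \<open>n\<close> is needed.\<close>
  have at: "{e \<in> Y. vs ! (Suc j mod n) \<in> f e} = Y \<inter> {es ! j, es ! (Suc j mod n)}"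
    if j: "j < n" and Y: "Y \<subseteq> set es" for j Y
  proof (intro set_eqI iffI)
    fix e assume e: "e \<in> {e \<in> Y. vs ! (Suc j mod n) \<in> f e}"
    then obtain i where i: "i < n" "e = es ! i" using Y unfolding n_def by (metis (no_types, lifting) in_set_conv_nth mem_Collect_eq subsetD)
    then have "vs ! (Suc j mod n) = vs ! i \<or> vs ! (Suc j mod n) = vs ! (Suc i mod n)" using e I(4)[OF i(1)] by auto
    then have "Suc j mod n = i \<or> j = i" using vinj sinj suc i j by blast
    then show "e \<in> Y \<inter> {es ! j, es ! (Suc j mod n)}" using e i by auto
  next
    fix e assume "e \<in> Y \<inter> {es ! j, es ! (Suc j mod n)}"
    then show "e \<in> {e \<in> Y. vs ! (Suc j mod n) \<in> f e}" using I(4)[OF j] I(4)[OF suc(1)[OF j]] by auto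
  qed
  have ne: "es ! j \<noteq> es ! (Suc j mod n)" if "j < n" for j
    using suc[OF that] that I(3) unfolding n_def by (metis nth_eq_iff_index_eq)
  have even: "odds f (set es) = {}"
  proof (rule ccontr)
    assume "odds f (set es) \<noteq> {}"
    then obtain v where v: "v \<in> odds f (set es)" by blast
    then have "v \<in> touched f (set es)" using odds_touched[of f "set es"] by blast
    then obtain m where m: "m < n" "v \<in> f (es ! m)"
      unfolding touched_def n_def by (auto simp: in_set_conv_nth)
    then have "v = vs ! m \<or> v = vs ! (Suc m mod n)" using I(4) by auto
    then obtain i where i: "i < n" "v = vs ! i" using m(1) suc(1) by blast
    obtain j where j: "j < n" "i = Suc j mod n"
    proof (cases i)
      case 0
      then show ?thesis using that[of "n - 1"] n by simp
    next
      case (Suc j)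
      then show ?thesis using that[of j] i by simp
    qed
    have "set es \<inter> {es ! j, es ! (Suc j mod n)} = {es ! j, es ! (Suc j mod n)}"
      using j suc(1) by (auto simp: n_def)
    then have "deg f (set es) v = 2" using at[OF j(1) subset_refl] i j ne[OF j(1)] by (simp add: deg_def)
    then show False using v by (simp add: odds_def)
  qed
  have "Y = {} \<or> Y = set es" if Y: "Y \<subseteq> set es" "odds f Y = {}" for Y
  proof -
    have st: "es ! j \<in> Y \<longleftrightarrow> es ! (Suc j mod n) \<in> Y" if j: "j < n" for j
    proof -
      have "even (deg f Y (vs ! (Suc j mod n)))" using Y(2) by (auto simp: odds_def)
      then have ev: "even (card (Y \<inter> {es ! j, es ! (Suc j mod n)}))" unfolding deg_def at[OF j Y(1)] .
      show ?thesis
        using ev ne[OF j] by (cases "es ! j \<in> Y"; cases "es ! (Suc j mod n) \<in> Y") simp_all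
    qed
    have "i < n \<Longrightarrow> es ! i \<in> Y \<longleftrightarrow> es ! 0 \<in> Y" for i
    proof (induction i)
      case (Suc i)
      then show ?case using st[of i] by simp
    qed simp
    then show ?thesis using Y(1) unfolding n_def by (metis all_not_in_conv in_set_conv_nth subsetD subsetI subset_antisym)
  qed
  then show "circuit (ends G) (cycle_edges C)"
    using even n unfolding circuit_def ce f_def by (auto simp: n_def)
qed

section \<open>Shortest long circuits are isometric\<close>

context loopless
begin

text \<open>The symmetric difference of \<open>C1\<close> and \<open>C2\<close> is even. Unless a
  circuit \<open>C3\<close> in it through \<open>e\<close> also contains \<open>h\<close>, there is
  a circuit \<open>C4\<close> through \<open>h\<close> disjoint from \<open>C3\<close>. Then the
  pair \<open>C3\<close>, \<open>C2\<close> or the pair \<open>C1\<close>, \<open>C4\<close> has a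
  smaller union, since an edge of \<open>C3\<close> in \<open>C2\<close> belongs to neither
  \<open>C1\<close> nor \<open>C4\<close>, and induction applies.\<close>

lemma common_circuit:
  assumes "C1 \<subseteq> E" "circuit f C1" "C2 \<subseteq> E" "circuit f C2" "e \<in> C1" "h \<in> C2" "C1 \<inter> C2 \<noteq> {}"
  shows "\<exists>D\<subseteq>C1 \<union> C2. circuit f D \<and> e \<in> D \<and> h \<in> D"
  using assms
proof (induction "card (C1 \<union> C2)" arbitrary: C1 C2 rule: less_induct)
  case less
  have fC: "finite C1" "finite C2" using less.prems finsub by auto
  let ?W = "sym_diff C1 C2"
  have WE: "?W \<subseteq> E" using less.prems by blast
  have Wev: "odds f ?W = {}" using odds_sym_diff[OF fC, of f] less.prems by (simp add: circuit_def)
  have sub1: "C = C1" if "C \<subseteq> C1" "circuit f C" for C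
    using that less.prems(2) unfolding circuit_def by metis
  have sub2: "C = C2" if "C \<subseteq> C2" "circuit f C" for C
    using that less.prems(4) unfolding circuit_def by metis
  show ?case
  proof (cases "h \<in> C1 \<or> e \<in> C2")
    case True
    then show ?thesis using less.prems by blast
  next
    case False
    then have eh: "e \<in> ?W" "h \<in> ?W" using less.prems by auto
    obtain C3 where C3: "C3 \<subseteq> ?W" "e \<in> C3" "circuit f C3" using circuit_in_even[OF WE Wev eh(1)] by blast
    show ?thesis
    proof (cases "h \<in> C3")
      case True
      then show ?thesis using C3 by blast
    next
      case h3: False
      have fW: "finite ?W" using fC by simp
      have "odds f (?W - C3) = {}" using odds_Diff[OF fW C3(1), of f] Wev C3(3) by (simp add: circuit_def)
      moreover have "?W - C3 \<subseteq> E" using WE by blast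
      moreover have "h \<in> ?W - C3" using eh h3 by blast
      ultimately obtain C4 where C4: "C4 \<subseteq> ?W - C3" "h \<in> C4" "circuit f C4"
        using circuit_in_even[of "?W - C3" h] by blast
      have i3: "C3 \<inter> C2 \<noteq> {}"
      proof
        assume d: "C3 \<inter> C2 = {}"
        then have "C3 = C1" using C3 by (intro sub1) auto
        then show False using d less.prems(7) by simp
      qed
      have i4: "C1 \<inter> C4 \<noteq> {}"
      proof
        assume d: "C1 \<inter> C4 = {}"
        then have "C4 = C2" using C4 by (intro sub2) auto
        then show False using d less.prems(7) by simp
      qed
      show ?thesis
      proof (cases "C3 \<union> C2 = C1 \<union> C2")
        case False
        have "C3 \<union> C2 \<subset> C1 \<union> C2" using False C3 by auto
        then have "card (C3 \<union> C2) < card (C1 \<union> C2)" using fC by (intro psubset_card_mono) auto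
        moreover have "C3 \<subseteq> E" using C3 WE by auto
        ultimately obtain D where "D \<subseteq> C3 \<union> C2" "circuit f D" "e \<in> D" "h \<in> D"
          using less.hyps[of C3 C2] C3 less.prems i3 by auto
        then show ?thesis using C3 by blast
      next
        case eq3: True
        show ?thesis
        proof (cases "C1 \<union> C4 = C1 \<union> C2")
          case False
          have "C1 \<union> C4 \<subset> C1 \<union> C2" using False C4 by auto
          then have "card (C1 \<union> C4) < card (C1 \<union> C2)" using fC by (intro psubset_card_mono) auto
          moreover have "C4 \<subseteq> E" using C4 WE by auto
          ultimately obtain D where "D \<subseteq> C1 \<union> C4" "circuit f D" "e \<in> D" "h \<in> D"
            using less.hyps[of C1 C4] C4 less.prems i4 by auto
          then show ?thesis using C4 by blast
        next
          case True
          obtain q where q: "q \<in> C3" "q \<in> C2" using i3 by blast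
          then have "q \<notin> C1" using C3 by auto
          then have "q \<in> C4" using q True by blast
          then show ?thesis using C4 q by blast
        qed
      qed
    qed
  qed
qed

text \<open>Otherwise every vertex of \<open>Z\<close> is joined to \<open>x\<close> by fewer than
  \<open>l\<close> edges; take \<open>y\<close> with the largest such join. An edge at
  \<open>y\<close> outside it would extend it to a neighbour, and together with the neighbour's own
  join form an even set smaller than \<open>Z\<close>, hence empty, so that the neighbour's join
  would be larger. Thus the join contains both edges at \<open>y\<close>, which forces
  \<open>x = y\<close> and an empty join.\<close>

lemma far_vertex:
  assumes Z: "Z \<subseteq> E" "circuit f Z" and c: "2 * l \<le> card Z" and x: "x \<in> touched f Z"
  shows "\<exists>y\<in>touched f Z. \<forall>J\<subseteq>Z. joins f J x y \<longrightarrow> l \<le> card J"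
proof (rule ccontr)
  assume "\<not> ?thesis"
  then have "\<forall>y\<in>touched f Z. \<exists>J. J \<subseteq> Z \<and> joins f J x y \<and> card J < l" by (meson not_le)
  from bchoice[OF this] obtain J where J: "\<forall>y\<in>touched f Z. J y \<subseteq> Z \<and> joins f (J y) x y \<and> card (J y) < l" ..
  have fZ: "finite Z" using Z finsub by blast
  have fJ: "finite (J y)" if "y \<in> touched f Z" for y using J that fZ by (meson finite_subset)
  have "\<exists>y. y \<in> touched f Z \<and> (\<forall>z. z \<in> touched f Z \<longrightarrow> card (J z) \<le> card (J y))"
    by (rule ex_has_greatest_nat[of _ x _ l]) (use J x in auto)
  then obtain y where y: "y \<in> touched f Z" and mx: "\<And>z. z \<in> touched f Z \<Longrightarrow> card (J z) \<le> card (J y)" by blast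
  have Jy: "J y \<subseteq> Z" "joins f (J y) x y" "card (J y) < l" using J y by auto
  have all: "e \<in> J y" if e: "e \<in> Z" "y \<in> f e" for e
  proof (rule ccontr)
    assume ne: "e \<notin> J y"
    obtain z where z: "f e = {y, z}" "z \<noteq> y" using other_end e Z by blast
    have zt: "z \<in> touched f Z" using z e by (auto simp: touched_def)
    have Jz: "J z \<subseteq> Z" "joins f (J z) x z" "card (J z) < l" using J zt by auto
    have s: "sym_diff (J y) {e} = insert e (J y)" using ne by auto
    have "joins f (sym_diff (J y) {e}) x z"
      by (rule joins_trans[OF fJ[OF y] _ Jy(2) joins_edge[OF z(1)]]) (use z in auto)
    then have "joins f (insert e (J y)) x z" by (simp only: s)
    then have ev: "odds f (sym_diff (insert e (J y)) (J z)) = {}"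
      using odds_sym_diff[of "insert e (J y)" "J z" f] fJ[OF y] fJ[OF zt] Jz(2) by (simp add: joins_def)
    have "card (sym_diff (insert e (J y)) (J z)) \<le> card (insert e (J y) \<union> J z)"
      using fJ[OF y] fJ[OF zt] by (intro card_mono) auto
    also have "\<dots> \<le> card (insert e (J y)) + card (J z)" by (rule card_Un_le)
    also have "\<dots> < card Z" using Jy(3) Jz(3) ne fJ[OF y] c by simp
    finally have "sym_diff (insert e (J y)) (J z) \<noteq> Z" by auto
    moreover have "sym_diff (insert e (J y)) (J z) \<subseteq> Z" using Jy(1) Jz(1) e by auto
    ultimately have "sym_diff (insert e (J y)) (J z) = {}" using ev Z(2) unfolding circuit_def by metis
    then have "J z = insert e (J y)" by auto
    then show False using mx[OF zt] ne fJ[OF y] by simp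
  qed
  have "{e \<in> J y. y \<in> f e} = {e \<in> Z. y \<in> f e}" using all Jy(1) by auto
  then have "deg f (J y) y = deg f Z y" by (simp add: deg_def)
  then have yo: "y \<notin> odds f (J y)" using circuit_deg_two[OF Z y] by (simp add: odds_def)
  have xy: "x = y" using Jy(2) yo by (cases "x = y") (auto simp: joins_ne)
  then have "odds f (J y) = {}" using Jy(2) by (simp add: joins_self)
  moreover have "J y \<noteq> Z" using Jy(3) c by auto
  ultimately have "J y = {}" using Z(2) Jy(1) unfolding circuit_def by metis
  then show False using y all by (auto simp: touched_def)
qed

text \<open>
  A shortest long circuit \<open>Z\<close> is isometric: a shortest shortcut \<open>Q\<close> between two of its vertices would
  meet \<open>Z\<close> only in its ends and form a shorter long circuit with the longer part of \<open>Z\<close>.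
\<close>

lemma no_long_circuit:
  assumes B: "B \<subseteq> E" and l: "2 \<le> l"
    and link: "\<And>e h. e \<in> B \<Longrightarrow> h \<in> B \<Longrightarrow> e \<noteq> h \<Longrightarrow> \<exists>D\<subseteq>B. circuit f D \<and> card D < l \<and> e \<in> D \<and> h \<in> D"
    and gap: "\<And>Z. Z \<subseteq> B \<Longrightarrow> circuit f Z \<Longrightarrow> card Z < l \<or> 2 * l \<le> card Z"
    and Z0: "Z0 \<subseteq> B" "circuit f Z0"
  shows "card Z0 < l"
proof (rule ccontr)
  assume "\<not> card Z0 < l"
  then have Z0l: "l \<le> card Z0" by simp
  have "\<exists>Z. (Z \<subseteq> B \<and> circuit f Z \<and> l \<le> card Z) \<and> (\<forall>Y. (Y \<subseteq> B \<and> circuit f Y \<and> l \<le> card Y) \<longrightarrow> card Z \<le> card Y)"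
    by (rule ex_has_least_nat[of _ Z0]) (simp add: Z0 Z0l)
  then obtain Z where Z: "Z \<subseteq> B" "circuit f Z" "l \<le> card Z"
    and Zmin: "\<And>Y. Y \<subseteq> B \<Longrightarrow> circuit f Y \<Longrightarrow> l \<le> card Y \<Longrightarrow> card Z \<le> card Y"
    by (elim exE conjE) metis
  have ZE: "Z \<subseteq> E" and cZ: "2 * l \<le> card Z" using Z B gap[of Z] by auto
  have fZ: "finite Z" using ZE finsub by blast
  \<comment> \<open>A shortcut: \<open>Q\<close> joins two vertices of \<open>Z\<close> with fewer
    edges than any join inside \<open>Z\<close>.\<close>
  define bad where "bad t \<longleftrightarrow> (case t of (x, y, Q) \<Rightarrow> x \<in> touched f Z \<and> y \<in> touched f Z \<and> Q \<subseteq> B \<and> joins f Q x y \<and>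
    (\<forall>J\<subseteq>Z. joins f J x y \<longrightarrow> card Q < card J))" for t
  \<comment> \<open>Two vertices that are far apart along \<open>Z\<close> lie on edges with a
    common short circuit, which supplies a shortcut.\<close>
  have "\<exists>t. bad t \<and> card (snd (snd t)) < l"
  proof -
    obtain e0 where "e0 \<in> Z" using Z(2) by (auto simp: circuit_def)
    then obtain x where x: "x \<in> touched f Z" using ends2[of e0] ZE by (force simp: touched_def card_2_iff)
    obtain y where y: "y \<in> touched f Z" and far: "\<And>J. J \<subseteq> Z \<Longrightarrow> joins f J x y \<Longrightarrow> l \<le> card J"
      using far_vertex[OF ZE Z(2) cZ x] by blast
    obtain e where e: "e \<in> Z" "x \<in> f e" using x by (auto simp: touched_def)
    obtain h where h: "h \<in> Z" "y \<in> f h" using y by (auto simp: touched_def)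
    have xy: "x \<noteq> y"
    proof
      assume "x = y"
      then show False using far[of "{}"] l by simp
    qed
    have "e \<noteq> h"
    proof
      assume "e = h"
      then have "f e = {x, y}" using other_end[of e x] e h ZE xy by (metis insert_iff singletonD subsetD)
      then show False using far[of "{e}"] e joins_edge[of e x y] xy l by simp
    qed
    then obtain D where D: "D \<subseteq> B" "circuit f D" "card D < l" "e \<in> D" "h \<in> D" using link[of e h] e h Z by blast
    have DE: "D \<subseteq> E" using D B by blast
    have "x \<in> touched f D" "y \<in> touched f D" using D e h by (auto simp: touched_def)
    then obtain Q where Q: "Q \<subseteq> D" "joins f Q x y" using circuit_join[OF DE D(2)] by blast
    have Ql: "card Q < l" using card_mono[OF finsub[OF DE] Q(1)] D(3) by linarith
    have "\<forall>J\<subseteq>Z. joins f J x y \<longrightarrow> card Q < card J" using Ql far less_le_trans by blast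
    then have "bad (x, y, Q)" unfolding bad_def prod.case using x y Q D by blast
    then show ?thesis using Ql by (intro exI[of _ "(x, y, Q)"]) simp
  qed
  then obtain t0 where t0: "bad t0" "card (snd (snd t0)) < l" by blast
  have "\<exists>t. bad t \<and> (\<forall>s. bad s \<longrightarrow> card (snd (snd t)) \<le> card (snd (snd s)))"
    by (rule ex_has_least_nat[of _ t0]) (rule t0)
  then obtain t where t: "bad t" and tmin: "\<And>s. bad s \<Longrightarrow> card (snd (snd t)) \<le> card (snd (snd s))" by blast
  obtain x y Q where tq: "t = (x, y, Q)" by (cases t)
  have x: "x \<in> touched f Z" and y: "y \<in> touched f Z" and QB: "Q \<subseteq> B" and QJ: "joins f Q x y"
    and far: "\<And>J. J \<subseteq> Z \<Longrightarrow> joins f J x y \<Longrightarrow> card Q < card J"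
    using t unfolding bad_def tq prod.case by blast+
  have Ql: "card Q < l" using tmin[OF t0(1)] t0(2) tq by simp
  have QE: "Q \<subseteq> E" using QB B by blast
  have fQ: "finite Q" using QE finsub by blast
  have min: "\<exists>J\<subseteq>Z. joins f J u v \<and> card J \<le> card R"
    if "u \<in> touched f Z" "v \<in> touched f Z" "R \<subseteq> B" "joins f R u v" "card R < card Q" for u v R
  proof (rule ccontr)
    assume "\<not> ?thesis"
    then have "bad (u, v, R)" using that unfolding bad_def prod.case not_le[symmetric] by blast
    then show False using tmin[of "(u, v, R)"] tq that(5) by simp
  qed
  have xy: "x \<noteq> y"
  proof
    assume "x = y"
    then show False using far[of "{}"] by simp
  qed
  have forest: "forest f Q"
    unfolding forest_def
  proof (intro allI impI, rule ccontr)
    fix Y assume Y: "Y \<subseteq> Q" "odds f Y = {}" "Y \<noteq> {}"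
    have "joins f (Q - Y) x y" using odds_Diff[OF fQ Y(1), of f] Y(2) QJ by (simp add: joins_def)
    moreover have lt: "card (Q - Y) < card Q" using Y fQ by (intro psubset_card_mono) auto
    ultimately obtain J where J: "J \<subseteq> Z" "joins f J x y" "card J \<le> card (Q - Y)" using min[of x y "Q - Y"] x y QB by blast
    then show False using far[OF J(1,2)] lt by linarith
  qed
  \<comment> \<open>A vertex of \<open>Z\<close> inside \<open>Q\<close> would split it into two
    smaller joins. Neither is a shortcut, so both can be replaced inside \<open>Z\<close> at no
    greater cost, and then \<open>Q\<close> would not be a shortcut either.\<close>
  have inner: "z \<in> {x, y}" if z: "z \<in> touched f Q" "z \<in> touched f Z" for z
  proof (rule ccontr)
    assume zn: "z \<notin> {x, y}"
    have "odds f Q \<subseteq> {x, y}" using QJ by (auto simp: joins_def)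
    then obtain Q1 where Q1: "Q1 \<subseteq> Q" "joins f Q1 x z"
      using reach[OF QE _ _ z(1), of x y] forest unfolding forest_def by blast
    have fQ1: "finite Q1" using Q1 fQ finite_subset by blast
    have s: "sym_diff Q1 Q = Q - Q1" using Q1 by auto
    have "joins f (sym_diff Q1 Q) z y" by (rule joins_trans[OF fQ1 fQ joins_sym[OF Q1(2)] QJ])
    then have J2: "joins f (Q - Q1) z y" by (simp only: s)
    have "Q1 \<noteq> {}" using Q1(2) zn by (auto simp: joins_empty_iff)
    then have l2: "card (Q - Q1) < card Q" using Q1(1) fQ by (intro psubset_card_mono) auto
    have "Q - Q1 \<noteq> {}" using J2 zn by (metis insertCI joins_empty_iff)
    then have l1: "card Q1 < card Q" using Q1(1) fQ by (intro psubset_card_mono) auto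
    obtain J1 where J1: "J1 \<subseteq> Z" "joins f J1 x z" "card J1 \<le> card Q1"
      using min[OF x z(2) _ Q1(2) l1] Q1(1) QB by blast
    obtain J2 where J2: "J2 \<subseteq> Z" "joins f J2 z y" "card J2 \<le> card (Q - Q1)"
      using min[OF z(2) y _ J2 l2] QB by blast
    have fJ: "finite J1" "finite J2" using J1(1) J2(1) fZ finite_subset by auto
    have "joins f (sym_diff J1 J2) x y" by (rule joins_trans[OF fJ J1(2) J2(2)])
    moreover have "sym_diff J1 J2 \<subseteq> Z" using J1(1) J2(1) by auto
    ultimately have "card Q < card (sym_diff J1 J2)" using far by blast
    also have "\<dots> \<le> card (J1 \<union> J2)" using fJ by (intro card_mono) auto
    also have "\<dots> \<le> card J1 + card J2" by (rule card_Un_le)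
    also have "\<dots> \<le> card Q1 + card (Q - Q1)" using J1(3) J2(3) by simp
    also have "\<dots> = card Q" using Q1(1) fQ fQ1 by (simp add: card_Diff_subset card_mono)
    finally show False by simp
  qed
  obtain X where X: "X \<subseteq> Z" "joins f X x y" using circuit_join[OF ZE Z(2) x y] by blast
  have ZX: "joins f (Z - X) x y" using odds_Diff[OF fZ X(1), of f] X(2) Z(2) by (simp add: joins_def circuit_def)
  \<comment> \<open>The longer arc of \<open>Z\<close> between \<open>x\<close> and
    \<open>y\<close>: it has at least half of the \<open>2 * l\<close> or more edges, while
    \<open>Q\<close> has fewer edges than the other arc.\<close>
  define Y where "Y = (if card X \<le> card (Z - X) then Z - X else X)"
  have fX: "finite X" using X fZ finite_subset by blast
  have cX: "card X + card (Z - X) = card Z" using X(1) fZ fX by (simp add: card_Diff_subset card_mono)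
  have YZ: "Y \<subseteq> Z" "joins f Y x y" using X ZX by (auto simp: Y_def)
  have Ybig: "l \<le> card Y" using cX cZ by (auto simp: Y_def)
  have Ysmall: "card Y + card Q < card Z" using far[of X] far[of "Z - X"] X ZX cX by (auto simp: Y_def)
  have disj: "Q \<inter> Z = {}"
  proof (rule ccontr)
    assume "Q \<inter> Z \<noteq> {}"
    then obtain e where e: "e \<in> Q" "e \<in> Z" by blast
    have "f e \<subseteq> {x, y}" using inner e by (force simp: touched_def)
    moreover have "card (f e) = 2" using ends2 e ZE by blast
    ultimately have "f e = {x, y}" using xy by (metis card_2_iff card_subset_eq finite.emptyI finite.insertI)
    then have "card Q < card {e}" using far[of "{e}"] e joins_edge[of e x y] xy by blast
    then show False using e fQ by auto
  qed
  have fY: "finite Y" using YZ fZ finite_subset by blast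
  have ev: "odds f (Y \<union> Q) = {}"
    using odds_Un_disjoint[OF fY fQ, of f] disj YZ QJ by (auto simp: joins_def)
  have YQB: "Y \<union> Q \<subseteq> B" using YZ QB Z by blast
  have "Y \<noteq> {}" using Ybig l by auto
  then obtain e where e: "e \<in> Y" by blast
  obtain K where K: "K \<subseteq> Y \<union> Q" "e \<in> K" "circuit f K"
    using circuit_in_even[OF _ ev, of e] YQB B e by blast
  have oK: "odds f (K \<inter> Y) \<subseteq> {x, y}"
  proof
    fix v assume v: "v \<in> odds f (K \<inter> Y)"
    show "v \<in> {x, y}"
    proof (rule ccontr)
      assume vn: "v \<notin> {x, y}"
      have "v \<in> touched f Z" using v odds_touched[of f "K \<inter> Y"] touched_mono[of "K \<inter> Y" Z f] YZ by blast
      then have "v \<notin> touched f Q" using inner vn by blast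
      then have "{d \<in> K. v \<in> f d} = {d \<in> K \<inter> Y. v \<in> f d}" using K(1) by (auto simp: touched_def)
      then have "v \<in> odds f K" using v by (simp add: odds_def deg_def)
      then show False using K(3) by (simp add: circuit_def)
    qed
  qed
  have KYE: "K \<inter> Y \<subseteq> E" using YZ ZE by blast
  have ne: "odds f (K \<inter> Y) \<noteq> {}"
  proof
    assume "odds f (K \<inter> Y) = {}"
    moreover have "K \<inter> Y \<subseteq> Z" "K \<inter> Y \<noteq> {}" using YZ K e by auto
    ultimately have "K \<inter> Y = Z" using Z(2) unfolding circuit_def by metis
    then have "Y = Z" using YZ by blast
    then show False using YZ(2) Z(2) xy by (simp add: joins_ne circuit_def)
  qed
  \<comment> \<open>\<open>Y\<close> is an arc of the circuit \<open>Z\<close>, so a circuit in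
    \<open>Y \<union> Q\<close> that uses an edge of \<open>Y\<close> uses all of it and is
    long.\<close>
  have "odds f (K \<inter> Y) = {x, y}" using odds_sub_pair[OF KYE oK ne] .
  then have "odds f (Y - K \<inter> Y) = {}"
    using odds_Diff[OF fY, of "K \<inter> Y" f] YZ(2) xy by (simp add: joins_ne)
  moreover have "Y - K \<inter> Y \<subseteq> Z" "Y - K \<inter> Y \<noteq> Z" using YZ e K by auto
  ultimately have "Y - K \<inter> Y = {}" using Z(2) unfolding circuit_def by metis
  then have "Y \<subseteq> K" by blast
  moreover have fK: "finite K" using K fY fQ by (meson finite_UnI finite_subset)
  ultimately have "l \<le> card K" using Ybig card_mono[OF fK, of Y] by linarith
  then have "card Z \<le> card K" using Zmin[of K] K YQB by blast
  also have "\<dots> \<le> card (Y \<union> Q)" using K(1) fY fQ by (intro card_mono) auto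
  also have "\<dots> \<le> card Y + card Q" by (rule card_Un_le)
  finally show False using Ysmall by simp
qed

end

section \<open>Partitions into pieces\<close>

definition attach :: "('e \<Rightarrow> 'v set) \<Rightarrow> 'e set set \<Rightarrow> 'e set \<Rightarrow> 'v set" where
  "attach f P B = {v \<in> touched f B. \<exists>B'\<in>P. B' \<noteq> B \<and> v \<in> touched f B'}"

text \<open>Edge-disjoint joins as in Menger's theorem. They are indexed by a set instead of being
  counted, so that they can be handed to the circuits of a packing that cross
  \<open>B\<close>.\<close>

definition joinable :: "('e \<Rightarrow> 'v set) \<Rightarrow> 'e set \<Rightarrow> 'v \<Rightarrow> 'v \<Rightarrow> nat set \<Rightarrow> bool" where
  "joinable f B u v I \<longleftrightarrow> (\<exists>R. disjoint_family_on R I \<and> (\<forall>i\<in>I. R i \<subseteq> B \<and> joins f (R i) u v))"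

text \<open>
  Deleting \<open>X\<close> from the piece \<open>B\<close> costs one connection between \<open>u\<close> and \<open>v\<close>: whatever routing
  through \<open>B\<close> avoids \<open>X\<close> can be replaced by one in \<open>B\<close> that leaves room for an additional join of
  \<open>u\<close> and \<open>v\<close>. If \<open>B\<close> has further attachments, then \<open>X\<close> is itself such a join.
\<close>

definition detour :: "('e \<Rightarrow> 'v set) \<Rightarrow> 'e set set \<Rightarrow> 'e set \<Rightarrow> 'v \<Rightarrow> 'v \<Rightarrow> 'e set \<Rightarrow> bool" where
  "detour f P B u v X \<longleftrightarrow> X \<subseteq> B \<and>
    (if attach f P B = {u, v}
     then \<forall>I j. finite I \<longrightarrow> j \<notin> I \<longrightarrow> joinable f (B - X) u v I \<longrightarrow> joinable f B u v (insert j I)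
     else joins f X u v)"

text \<open>What merging in series preserves. Small joins of the attachments are not among it; the
  last clause asks only for small detours, which an unmerged piece gets from its small
  joins.\<close>

definition good :: "('e \<Rightarrow> 'v set) \<Rightarrow> 'e set \<Rightarrow> nat \<Rightarrow> 'e set set \<Rightarrow> bool" where
  "good f E l P \<longleftrightarrow> partition_on E P \<and>
    (\<forall>B\<in>P. \<forall>Z\<subseteq>B. circuit f Z \<longrightarrow> card Z < l) \<and>
    (\<forall>Z\<subseteq>E. circuit f Z \<longrightarrow> card Z < l \<longrightarrow> (\<exists>B\<in>P. Z \<subseteq> B)) \<and>
    (\<forall>B\<in>P. \<forall>u\<in>touched f B. \<forall>v\<in>touched f B. \<exists>Q\<subseteq>B. joins f Q u v) \<and>
    (\<forall>B\<in>P. \<forall>u\<in>attach f P B. \<forall>v\<in>attach f P B. u \<noteq> v \<longrightarrow> (\<exists>X. detour f P B u v X \<and> card X < l))"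

section \<open>Families of disjoint joins and detours\<close>

lemma joinable_sym: "joinable f B u v I \<Longrightarrow> joinable f B v u I"
  unfolding joinable_def using joins_sym by metis

lemma joinable_card:
  assumes "joinable f B u v I" "finite I" "finite J" "card J \<le> card I"
  shows "joinable f B u v J"
proof -
  obtain h where h: "inj_on h J" "h ` J \<subseteq> I" using card_le_inj[OF assms(3,2,4)] by blast
  obtain R where R: "disjoint_family_on R I" "\<forall>i\<in>I. R i \<subseteq> B \<and> joins f (R i) u v"
    using assms(1) unfolding joinable_def by blast
  have "disjoint_family_on (\<lambda>j. R (h j)) J"
    using R(1) h unfolding disjoint_family_on_def inj_on_def by (metis image_subset_iff)
  then show ?thesis using R(2) h(2) unfolding joinable_def by (intro exI[of _ "\<lambda>j. R (h j)"]) auto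
qed

lemma joinable_insert:
  assumes "joinable f (B - X) u v I" "j \<notin> I" "X \<subseteq> B" "joins f X u v"
  shows "joinable f B u v (insert j I)"
proof -
  obtain R where R: "disjoint_family_on R I" "\<forall>i\<in>I. R i \<subseteq> B - X \<and> joins f (R i) u v"
    using assms(1) unfolding joinable_def by blast
  have "disjoint_family_on (R(j := X)) (insert j I)"
    using R assms(2) unfolding disjoint_family_on_def by (auto; blast)
  moreover have "\<forall>i\<in>insert j I. (R(j := X)) i \<subseteq> B \<and> joins f ((R(j := X)) i) u v"
    using R(2) assms by auto
  ultimately show ?thesis unfolding joinable_def by blast
qed

lemma detour_of_join: "X \<subseteq> B \<Longrightarrow> joins f X u v \<Longrightarrow> detour f P B u v X"
  unfolding detour_def using joinable_insert by metis

lemma detour_sym: "detour f P B u v X \<Longrightarrow> detour f P B v u X"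
  unfolding detour_def using joinable_sym joins_sym by (metis insert_commute)

lemma attach_touched: "attach f P B \<subseteq> touched f B"
  by (auto simp: attach_def)

section \<open>Merging pieces in series, and the existence of good partitions\<close>

context loopless
begin

text \<open>At a vertex of \<open>B\<close> lying in no other piece, all edges of \<open>A\<close>
  belong to \<open>B\<close>, so its parity in \<open>A \<inter> B\<close> is that in
  \<open>A\<close>.\<close>

lemma odds_piece:
  assumes P: "partition_on E P" "B \<in> P" and A: "A \<subseteq> E" "odds f A = {}"
  shows "odds f (A \<inter> B) \<subseteq> attach f P B"
proof
  fix v assume v: "v \<in> odds f (A \<inter> B)"
  then have vB: "v \<in> touched f B" using odds_touched touched_mono by (metis Int_lower2 subsetD)
  show "v \<in> attach f P B"
  proof (rule ccontr)
    assume n: "v \<notin> attach f P B"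
    have "e \<in> B" if e: "e \<in> A" "v \<in> f e" for e
    proof -
      obtain B' where "B' \<in> P" "e \<in> B'" using e A(1) partition_onD1[OF P(1)] by blast
      then show ?thesis using n vB e by (auto simp: attach_def touched_def)
    qed
    then have "{e \<in> A \<inter> B. v \<in> f e} = {e \<in> A. v \<in> f e}" by blast
    then have "v \<in> odds f A" using v by (simp add: odds_def deg_def)
    then show False using A(2) by simp
  qed
qed

text \<open>A join is cut at the cut vertex \<open>v\<close>: the other vertices of
  \<open>A1\<close> keep their parity, and the handshake lemma forces \<open>v\<close> to become the
  second odd vertex.\<close>

lemma half_join:
  assumes A: "A1 \<union> A2 \<subseteq> E" "touched f A1 \<inter> touched f A2 \<subseteq> {v}" "u \<notin> touched f A2" "w \<notin> touched f A1"
    and R: "R \<subseteq> A1 \<union> A2" "odds f R = {u, w}"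
  shows "odds f (R \<inter> A1) = {u, v}"
proof (rule odds_sub_pair)
  have eq: "deg f (R \<inter> A1) z = deg f R z" if "z \<notin> touched f A2" for z
  proof -
    have "{e \<in> R \<inter> A1. z \<in> f e} = {e \<in> R. z \<in> f e}" using that R(1) by (auto simp: touched_def)
    then show ?thesis by (simp add: deg_def)
  qed
  show "R \<inter> A1 \<subseteq> E" using A by blast
  show "odds f (R \<inter> A1) \<subseteq> {u, v}"
  proof
    fix z assume z: "z \<in> odds f (R \<inter> A1)"
    then have z1: "z \<in> touched f A1" using odds_touched touched_mono by (metis Int_lower2 subsetD)
    show "z \<in> {u, v}"
    proof (cases "z \<in> touched f A2")
      case True
      then show ?thesis using z1 A(2) by blast
    next
      case False
      then have "z \<in> odds f R" using z eq[OF False] by (simp add: odds_def)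
      then show ?thesis using R(2) z1 A(4) by blast
    qed
  qed
  have "u \<in> odds f R" using R(2) by simp
  then have "u \<in> odds f (R \<inter> A1)" using eq[OF A(3)] by (simp add: odds_def)
  then show "odds f (R \<inter> A1) \<noteq> {}" by blast
qed

text \<open>The maximum number of disjoint joins through a series composition is the smaller of the
  maxima of its halves; the common index set matches the joins of the halves.\<close>

lemma joinable_series:
  assumes A: "A1 \<union> A2 \<subseteq> E" "A1 \<inter> A2 = {}" "touched f A1 \<inter> touched f A2 \<subseteq> {v}"
    and uw: "u \<notin> touched f A2" "w \<notin> touched f A1" "u \<noteq> v" "v \<noteq> w" "u \<noteq> w"
  shows "joinable f (A1 \<union> A2) u w I \<longleftrightarrow> joinable f A1 u v I \<and> joinable f A2 v w I"
proof
  assume "joinable f (A1 \<union> A2) u w I"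
  then obtain R where R: "disjoint_family_on R I" "\<And>i. i \<in> I \<Longrightarrow> R i \<subseteq> A1 \<union> A2 \<and> odds f (R i) = {u, w}"
    using uw unfolding joinable_def by (auto simp: joins_ne)
  have d: "disjoint_family_on (\<lambda>i. R i \<inter> A1) I" "disjoint_family_on (\<lambda>i. R i \<inter> A2) I"
    using R(1) unfolding disjoint_family_on_def by blast+
  have "odds f (R i \<inter> A1) = {u, v}" if i: "i \<in> I" for i
    by (rule half_join[of A1 A2 v u w]) (use A uw R(2)[OF i] in auto)
  moreover have "odds f (R i \<inter> A2) = {w, v}" if i: "i \<in> I" for i
    by (rule half_join[of A2 A1 v w u]) (use A uw R(2)[OF i] in auto)
  ultimately show "joinable f A1 u v I \<and> joinable f A2 v w I"
    using d uw unfolding joinable_def by (auto simp: joins_ne insert_commute)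
next
  assume "joinable f A1 u v I \<and> joinable f A2 v w I"
  then obtain R S where R: "disjoint_family_on R I" "\<And>i. i \<in> I \<Longrightarrow> R i \<subseteq> A1 \<and> joins f (R i) u v"
    and S: "disjoint_family_on S I" "\<And>i. i \<in> I \<Longrightarrow> S i \<subseteq> A2 \<and> joins f (S i) v w"
    unfolding joinable_def by blast
  have "joins f (R i \<union> S i) u w" if i: "i \<in> I" for i
  proof -
    have "finite (R i)" "finite (S i)" using R(2)[OF i] S(2)[OF i] A(1) finsub by auto
    then have "joins f (sym_diff (R i) (S i)) u w"
      by (rule joins_trans) (use R(2)[OF i] S(2)[OF i] in auto)
    moreover have "sym_diff (R i) (S i) = R i \<union> S i" using R(2)[OF i] S(2)[OF i] A(2) by blast
    ultimately show ?thesis by simp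
  qed
  moreover have "disjoint_family_on (\<lambda>i. R i \<union> S i) I"
    unfolding disjoint_family_on_def
  proof (intro ballI impI)
    fix i j assume ij: "i \<in> I" "j \<in> I" "i \<noteq> j"
    then have "R i \<inter> R j = {}" "S i \<inter> S j = {}" using R(1) S(1) unfolding disjoint_family_on_def by auto
    then show "(R i \<union> S i) \<inter> (R j \<union> S j) = {}"
      using R(2)[OF ij(1)] R(2)[OF ij(2)] S(2)[OF ij(1)] S(2)[OF ij(2)] A(2) by blast
  qed
  ultimately show "joinable f (A1 \<union> A2) u w I"
    using R(2) S(2) unfolding joinable_def by (intro exI[of _ "\<lambda>i. R i \<union> S i"]) blast
qed

text \<open>Only \<open>v\<close> is shared by the two halves, so a circuit in the merged piece lies
  in one half and remains short. As \<open>v\<close> touches no third piece, it stops being an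
  attachment and only \<open>u\<close> and \<open>w\<close> remain. The detour of a half that admits
  no more disjoint joins than the other serves for the whole.\<close>

lemma good_merge:
  assumes P: "good f E l P" and B: "B1 \<in> P" "B2 \<in> P" "B1 \<noteq> B2"
    and at: "attach f P B1 = {u, v}" "attach f P B2 = {v, w}" and ne: "u \<noteq> v" "v \<noteq> w" "u \<noteq> w"
    and only: "\<And>B. B \<in> P \<Longrightarrow> v \<in> touched f B \<Longrightarrow> B = B1 \<or> B = B2"
  shows "good f E l (insert (B1 \<union> B2) (P - {B1, B2}))"
proof -
  define B where "B = B1 \<union> B2"
  define P' where "P' = insert B (P - {B1, B2})"
  have part: "partition_on E P" and g1: "\<And>B Z. B \<in> P \<Longrightarrow> Z \<subseteq> B \<Longrightarrow> circuit f Z \<Longrightarrow> card Z < l"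
    and g2: "\<And>Z. Z \<subseteq> E \<Longrightarrow> circuit f Z \<Longrightarrow> card Z < l \<Longrightarrow> \<exists>B\<in>P. Z \<subseteq> B"
    and g3: "\<And>B u v. B \<in> P \<Longrightarrow> u \<in> touched f B \<Longrightarrow> v \<in> touched f B \<Longrightarrow> \<exists>Q\<subseteq>B. joins f Q u v"
    and g4: "\<And>B u v. B \<in> P \<Longrightarrow> u \<in> attach f P B \<Longrightarrow> v \<in> attach f P B \<Longrightarrow> u \<noteq> v \<Longrightarrow> \<exists>X. detour f P B u v X \<and> card X < l"
    using P unfolding good_def by blast+
  have BE: "B1 \<subseteq> E" "B2 \<subseteq> E" using partition_onD1[OF part] B by auto
  have nonempty: "B1 \<noteq> {}" "B2 \<noteq> {}" using partition_onD3[OF part] B by auto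
  have dis: "X \<inter> Y = {}" if "X \<in> P" "Y \<in> P" "X \<noteq> Y" for X Y
    using partition_onD2[OF part] that by (auto simp: pairwise_def disjnt_def)
  have B12: "B1 \<inter> B2 = {}" using dis B by blast
  have BnP: "B \<notin> P - {B1, B2}" using dis[of B B1] B nonempty by (auto simp: B_def)
  have part': "partition_on E P'"
  proof (rule partition_onI)
    show "\<Union>P' = E" using partition_onD1[OF part] B by (auto simp: P'_def B_def)
    show "{} \<notin> P'" using partition_onD3[OF part] nonempty by (auto simp: P'_def B_def)
    show "disjnt p q" if "p \<in> P'" "q \<in> P'" "p \<noteq> q" for p q
      using that dis B unfolding P'_def B_def disjnt_def by blast
  qed
  have t12: "touched f B1 \<inter> touched f B2 = {v}"
  proof
    show "touched f B1 \<inter> touched f B2 \<subseteq> {v}"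
    proof
      fix z assume "z \<in> touched f B1 \<inter> touched f B2"
      then have "z \<in> attach f P B1" "z \<in> attach f P B2" using B by (auto simp: attach_def)
      then show "z \<in> {v}" using at ne by auto
    qed
    show "{v} \<subseteq> touched f B1 \<inter> touched f B2" using at attach_touched[of f P] by blast
  qed
  have u1: "u \<in> touched f B1" and w2: "w \<in> touched f B2" using at attach_touched[of f P] by blast+
  have u2: "u \<notin> touched f B2" using t12 u1 ne(1) by (metis IntI singletonD)
  have w1: "w \<notin> touched f B1" using t12 w2 ne(2) by (metis IntI singletonD)
  have tB: "touched f B = touched f B1 \<union> touched f B2" by (simp add: B_def touched_Un)
  have atB: "attach f P' B = {u, w}"
  proof
    show "attach f P' B \<subseteq> {u, w}"
    proof
      fix z assume "z \<in> attach f P' B"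
      then obtain C where C: "C \<in> P" "C \<noteq> B1" "C \<noteq> B2" "z \<in> touched f C" "z \<in> touched f B1 \<or> z \<in> touched f B2"
        by (auto simp: attach_def P'_def tB)
      have "z \<noteq> v" using only C by blast
      moreover have "z \<in> attach f P B1 \<or> z \<in> attach f P B2" using C by (auto simp: attach_def)
      ultimately show "z \<in> {u, w}" using at by auto
    qed
    have "u \<in> attach f P' B"
    proof -
      have "u \<in> attach f P B1" using at by simp
      then obtain C where "C \<in> P" "C \<noteq> B1" "u \<in> touched f C" by (auto simp: attach_def)
      then have "C \<in> P'" "C \<noteq> B" "u \<in> touched f C" using u2 BnP by (auto simp: P'_def)
      then show ?thesis using u1 by (auto simp: attach_def tB)
    qed
    moreover have "w \<in> attach f P' B"
    proof -
      have "w \<in> attach f P B2" using at by simp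
      then obtain C where "C \<in> P" "C \<noteq> B2" "w \<in> touched f C" by (auto simp: attach_def)
      then have "C \<in> P'" "C \<noteq> B" "w \<in> touched f C" using w1 BnP by (auto simp: P'_def)
      then show ?thesis using w2 by (auto simp: attach_def tB)
    qed
    ultimately show "{u, w} \<subseteq> attach f P' B" by blast
  qed
  have atC: "attach f P' C = attach f P C" if C: "C \<in> P" "C \<noteq> B1" "C \<noteq> B2" for C
  proof -
    have "C \<noteq> B" using C BnP by blast
    have "(\<exists>D\<in>P'. D \<noteq> C \<and> z \<in> touched f D) \<longleftrightarrow> (\<exists>D\<in>P. D \<noteq> C \<and> z \<in> touched f D)" for z
    proof
      assume "\<exists>D\<in>P'. D \<noteq> C \<and> z \<in> touched f D"
      then obtain D where D: "D \<in> P'" "D \<noteq> C" "z \<in> touched f D" by blast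
      show "\<exists>D\<in>P. D \<noteq> C \<and> z \<in> touched f D"
      proof (cases "D = B")
        case True
        then have "z \<in> touched f B1 \<or> z \<in> touched f B2" using D(3) tB by blast
        then show ?thesis using B C by blast
      next
        case False
        then show ?thesis using D by (auto simp: P'_def)
      qed
    next
      assume "\<exists>D\<in>P. D \<noteq> C \<and> z \<in> touched f D"
      then obtain D where D: "D \<in> P" "D \<noteq> C" "z \<in> touched f D" by blast
      show "\<exists>D\<in>P'. D \<noteq> C \<and> z \<in> touched f D"
      proof (cases "D = B1 \<or> D = B2")
        case True
        then have "z \<in> touched f B" using D(3) tB by blast
        then show ?thesis using \<open>C \<noteq> B\<close> by (auto simp: P'_def)
      next
        case False
        then show ?thesis using D by (auto simp: P'_def)
      qed
    qed
    then show ?thesis by (auto simp: attach_def)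
  qed
  have h1: "card Z < l" if C: "C \<in> P'" and Z: "Z \<subseteq> C" "circuit f Z" for C Z
  proof (cases "C = B")
    case True
    have "odds f (Z \<inter> B1) \<subseteq> {v}"
    proof
      fix z assume z: "z \<in> odds f (Z \<inter> B1)"
      then have z1: "z \<in> touched f B1" using odds_touched touched_mono by (metis Int_lower2 subsetD)
      show "z \<in> {v}"
      proof (rule ccontr)
        assume "z \<notin> {v}"
        then have "z \<notin> touched f B2" using z1 t12 by blast
        then have "{e \<in> Z \<inter> B1. z \<in> f e} = {e \<in> Z. z \<in> f e}"
          using Z(1) True by (auto simp: touched_def B_def)
        then have "z \<in> odds f Z" using z by (simp add: odds_def deg_def)
        then show False using Z(2) by (simp add: circuit_def)
      qed
    qed
    then have "odds f (Z \<inter> B1) = {}" by (rule odds_sub_single[rotated]) (use BE in auto)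
    then have "Z \<inter> B1 = {} \<or> Z \<inter> B1 = Z" using Z(2) unfolding circuit_def by (metis Int_lower1)
    then have "Z \<subseteq> B2 \<or> Z \<subseteq> B1" using Z(1) True by (auto simp: B_def)
    then show ?thesis using g1 B Z(2) by blast
  next
    case False
    then show ?thesis using g1 C Z by (auto simp: P'_def)
  qed
  have h2: "\<exists>B\<in>P'. Z \<subseteq> B" if Z: "Z \<subseteq> E" "circuit f Z" "card Z < l" for Z
  proof -
    obtain C where C: "C \<in> P" "Z \<subseteq> C" using g2 Z by blast
    show ?thesis
    proof (cases "C = B1 \<or> C = B2")
      case True
      then have "Z \<subseteq> B" using C(2) by (auto simp: B_def)
      then show ?thesis by (simp add: P'_def)
    next
      case False
      then show ?thesis using C by (auto simp: P'_def)
    qed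
  qed
  have h3: "\<exists>Q\<subseteq>C. joins f Q x y" if C: "C \<in> P'" and xy: "x \<in> touched f C" "y \<in> touched f C" for C x y
  proof (cases "C = B")
    case True
    have tov: "\<exists>Q\<subseteq>B. joins f Q z v" if z: "z \<in> touched f B" for z
    proof -
      have "\<exists>D\<in>{B1, B2}. z \<in> touched f D \<and> v \<in> touched f D" using z t12 by (auto simp: tB)
      then obtain D where D: "D \<in> {B1, B2}" "z \<in> touched f D" "v \<in> touched f D" by blast
      then have "D \<in> P" using B by blast
      then obtain Q where "Q \<subseteq> D" "joins f Q z v" using g3 D by blast
      moreover have "D \<subseteq> B" using D(1) by (auto simp: B_def)
      ultimately show ?thesis by blast
    qed
    obtain Q1 where Q1: "Q1 \<subseteq> B" "joins f Q1 x v" using tov xy True by blast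
    obtain Q2 where Q2: "Q2 \<subseteq> B" "joins f Q2 y v" using tov xy True by blast
    have "Q1 \<subseteq> E" "Q2 \<subseteq> E" using Q1(1) Q2(1) BE by (auto simp: B_def)
    then have "joins f (sym_diff Q1 Q2) x y"
      by (intro joins_trans[OF _ _ Q1(2) joins_sym[OF Q2(2)]] finsub)
    moreover have "sym_diff Q1 Q2 \<subseteq> B" using Q1(1) Q2(1) by auto
    ultimately show ?thesis using True by blast
  next
    case False
    then show ?thesis using g3 C xy by (auto simp: P'_def)
  qed
  obtain X1 where X1: "detour f P B1 u v X1" "card X1 < l" using g4[OF B(1)] at ne by blast
  obtain X2 where X2: "detour f P B2 v w X2" "card X2 < l" using g4[OF B(2)] at ne by blast
  have X1B: "X1 \<subseteq> B1" and X2B: "X2 \<subseteq> B2" using X1 X2 by (auto simp: detour_def)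
  have d1: "joinable f B1 u v (insert j I)" if "finite I" "j \<notin> I" "joinable f (B1 - X1) u v I" for I j
    using X1(1) at(1) that unfolding detour_def by simp
  have d2: "joinable f B2 v w (insert j I)" if "finite I" "j \<notin> I" "joinable f (B2 - X2) v w I" for I j
    using X2(1) at(2) that unfolding detour_def by simp
  have ser: "joinable f (A1 \<union> A2) u w I \<longleftrightarrow> joinable f A1 u v I \<and> joinable f A2 v w I"
    if "A1 \<subseteq> B1" "A2 \<subseteq> B2" for A1 A2 I
  proof (rule joinable_series)
    have "touched f A1 \<subseteq> touched f B1" "touched f A2 \<subseteq> touched f B2" using that touched_mono by metis+
    then show "touched f A1 \<inter> touched f A2 \<subseteq> {v}" "u \<notin> touched f A2" "w \<notin> touched f A1"
      using t12 u2 w1 by blast+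
  qed (use that BE B12 ne in auto)
  have e1: "B - X1 = (B1 - X1) \<union> B2" and e2: "B - X2 = B1 \<union> (B2 - X2)"
    using X1B X2B B12 by (auto simp: B_def)
  \<comment> \<open>If neither detour served, each half would carry a family whose index set the
    other half cannot carry; but the half with the larger family carries one of the smaller size as
    well.\<close>
  have "(\<forall>I j. finite I \<longrightarrow> j \<notin> I \<longrightarrow> joinable f (B - X1) u w I \<longrightarrow> joinable f B u w (insert j I)) \<or>
    (\<forall>I j. finite I \<longrightarrow> j \<notin> I \<longrightarrow> joinable f (B - X2) u w I \<longrightarrow> joinable f B u w (insert j I))"
  proof (rule ccontr)
    assume n: "\<not> ?thesis"
    then obtain I1 j1 where I1: "finite I1" "j1 \<notin> I1" "joinable f (B - X1) u w I1" "\<not> joinable f B u w (insert j1 I1)"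
      by blast
    from n obtain I2 j2 where I2: "finite I2" "j2 \<notin> I2" "joinable f (B - X2) u w I2" "\<not> joinable f B u w (insert j2 I2)"
      by blast
    have "joinable f (B1 - X1) u v I1" using I1(3) ser[of "B1 - X1" B2 I1] e1 by auto
    then have a1: "joinable f B1 u v (insert j1 I1)" using d1 I1 by blast
    have "joinable f (B2 - X2) v w I2" using I2(3) ser[of B1 "B2 - X2" I2] e2 by auto
    then have a2: "joinable f B2 v w (insert j2 I2)" using d2 I2 by blast
    have b1: "\<not> joinable f B2 v w (insert j1 I1)" using a1 I1(4) ser[of B1 B2] by (auto simp: B_def)
    have b2: "\<not> joinable f B1 u v (insert j2 I2)" using a2 I2(4) ser[of B1 B2] by (auto simp: B_def)
    have "card (insert j1 I1) \<le> card (insert j2 I2) \<or> card (insert j2 I2) \<le> card (insert j1 I1)" by linarith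
    then show False using joinable_card[OF a2, of "insert j1 I1"] joinable_card[OF a1, of "insert j2 I2"] b1 b2 I1(1) I2(1)
      by auto
  qed
  then obtain X where X: "X \<in> {X1, X2}"
    "\<forall>I j. finite I \<longrightarrow> j \<notin> I \<longrightarrow> joinable f (B - X) u w I \<longrightarrow> joinable f B u w (insert j I)" by blast
  have XB: "detour f P' B u w X" "card X < l"
    using X X1B X2B X1(2) X2(2) atB unfolding detour_def by (auto simp: B_def)
  have h4: "\<exists>X. detour f P' C x y X \<and> card X < l"
    if C: "C \<in> P'" and xy: "x \<in> attach f P' C" "y \<in> attach f P' C" "x \<noteq> y" for C x y
  proof (cases "C = B")
    case True
    then have "(x = u \<and> y = w) \<or> (x = w \<and> y = u)" using xy atB by auto
    then show ?thesis using XB detour_sym[OF XB(1)] True by blast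
  next
    case False
    then have CP: "C \<in> P" "C \<noteq> B1" "C \<noteq> B2" using C by (auto simp: P'_def)
    then obtain X where X: "detour f P C x y X" "card X < l" using g4[of C x y] xy atC[OF CP] by auto
    have "detour f P' C x y X" using X(1) unfolding detour_def atC[OF CP] .
    then show ?thesis using X(2) by blast
  qed
  have "good f E l P'"
    unfolding good_def by (intro conjI ballI allI impI; (rule part' h1 h2 h3 h4; assumption)?)
  then show ?thesis by (simp add: P'_def B_def)
qed

text \<open>Transitivity is where the gap enters: two short circuits with a common edge yield a
  circuit inside their union, which has fewer than \<open>2 * l\<close> edges and so fewer than
  \<open>l\<close>. An edge on no short circuit is a piece of its own. The detours are joins
  consisting of a single edge or taken from a common short circuit.\<close>

lemma good_exists:
  assumes l: "2 \<le> l" and gap: "\<And>Z. Z \<subseteq> E \<Longrightarrow> circuit f Z \<Longrightarrow> card Z < l \<or> 2 * l \<le> card Z"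
  shows "\<exists>P. good f E l P"
proof -
  define r where "r = {(e, h). e \<in> E \<and> h \<in> E \<and> (e = h \<or> (\<exists>D\<subseteq>E. circuit f D \<and> card D < l \<and> e \<in> D \<and> h \<in> D))}"
  have "equiv E r"
  proof (rule equivI)
    show "refl_on E r" by (auto simp: refl_on_def r_def)
    show "r \<subseteq> E \<times> E" by (auto simp: r_def)
    show "sym r" by (auto simp: sym_def r_def)
    show "trans r"
    proof (rule transI)
      fix x y z assume xy: "(x, y) \<in> r" and yz: "(y, z) \<in> r"
      show "(x, z) \<in> r"
      proof (cases "x = y \<or> y = z")
        case True
        then show ?thesis using xy yz by auto
      next
        case False
        obtain C1 where C1: "C1 \<subseteq> E" "circuit f C1" "card C1 < l" "x \<in> C1" "y \<in> C1"
          using xy False by (auto simp: r_def)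
        obtain C2 where C2: "C2 \<subseteq> E" "circuit f C2" "card C2 < l" "y \<in> C2" "z \<in> C2"
          using yz False by (auto simp: r_def)
        obtain D where D: "D \<subseteq> C1 \<union> C2" "circuit f D" "x \<in> D" "z \<in> D"
          using common_circuit[OF C1(1,2) C2(1,2) C1(4) C2(5)] C1(5) C2(4) by blast
        have "card D \<le> card (C1 \<union> C2)" using D(1) C1(1) C2(1) finsub by (intro card_mono) auto
        also have "\<dots> \<le> card C1 + card C2" by (rule card_Un_le)
        finally have "card D < 2 * l" using C1(3) C2(3) by linarith
        moreover have "D \<subseteq> E" using D(1) C1(1) C2(1) by blast
        ultimately have "D \<subseteq> E" "card D < l" using gap[of D] D(2) by auto
        then show ?thesis using D C1(1,4) C2(1,5) unfolding r_def by blast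
      qed
    qed
  qed
  define P where "P = E // r"
  have part: "partition_on E P" unfolding P_def by (rule partition_on_quotient) fact
  have cls: "(e, h) \<in> r" if "B \<in> P" "e \<in> B" "h \<in> B" for B e h
    using that quotient_eq_iff[OF \<open>equiv E r\<close>, of B B e h] unfolding P_def by blast
  have clo: "h \<in> B" if "B \<in> P" "e \<in> B" "(e, h) \<in> r" for B e h
    using that in_quotient_imp_closed[OF \<open>equiv E r\<close>, of B e h] unfolding P_def by blast
  have PE: "B \<subseteq> E" if "B \<in> P" for B using partition_onD1[OF part] that by blast
  have link: "\<exists>D\<subseteq>B. circuit f D \<and> card D < l \<and> e \<in> D \<and> h \<in> D" if B: "B \<in> P" "e \<in> B" "h \<in> B" "e \<noteq> h" for B e h
  proof -
    obtain D where D: "D \<subseteq> E" "circuit f D" "card D < l" "e \<in> D" "h \<in> D"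
      using cls[OF B(1-3)] B(4) by (auto simp: r_def)
    have "d \<in> B" if "d \<in> D" for d
    proof -
      have "(e, d) \<in> r" using that D by (auto simp: r_def)
      then show ?thesis using clo B by blast
    qed
    then show ?thesis using D by blast
  qed
  have pj: "\<exists>X\<subseteq>B. joins f X u v \<and> card X < l" if B: "B \<in> P" and uv: "u \<in> touched f B" "v \<in> touched f B" "u \<noteq> v" for B u v
  proof -
    obtain e where e: "e \<in> B" "u \<in> f e" using uv by (auto simp: touched_def)
    obtain h where h: "h \<in> B" "v \<in> f h" using uv by (auto simp: touched_def)
    show ?thesis
    proof (cases "e = h")
      case True
      obtain z where "f e = {u, z}" using other_end e PE[OF B] by blast
      then have "f e = {u, v}" using True h uv(3) by auto
      then have "joins f {e} u v" using uv(3) by (rule joins_edge)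
      then show ?thesis using e l by (intro exI[of _ "{e}"]) auto
    next
      case False
      obtain D where D: "D \<subseteq> B" "circuit f D" "card D < l" "e \<in> D" "h \<in> D" using link[OF B e(1) h(1) False] by blast
      have DE: "D \<subseteq> E" using D(1) PE[OF B] by blast
      have "u \<in> touched f D" "v \<in> touched f D" using D e h by (auto simp: touched_def)
      then obtain X where X: "X \<subseteq> D" "joins f X u v" using circuit_join[OF DE D(2)] by blast
      have "card X \<le> card D" using card_mono[OF finsub[OF DE] X(1)] .
      then show ?thesis using X D by (intro exI[of _ X]) auto
    qed
  qed
  have "good f E l P"
    unfolding good_def
  proof (intro conjI ballI allI impI)
    show "partition_on E P" by fact
    show "card Z < l" if "B \<in> P" "Z \<subseteq> B" "circuit f Z" for B Z
    proof (rule no_long_circuit[OF PE[OF that(1)] l])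
      show "\<exists>D\<subseteq>B. circuit f D \<and> card D < l \<and> e \<in> D \<and> h \<in> D" if "e \<in> B" "h \<in> B" "e \<noteq> h" for e h
        using link[OF \<open>B \<in> P\<close> that] .
      show "card Z < l \<or> 2 * l \<le> card Z" if "Z \<subseteq> B" "circuit f Z" for Z
        using gap[OF _ that(2)] that(1) PE[OF \<open>B \<in> P\<close>] by blast
    qed (use that in auto)
    show "\<exists>B\<in>P. Z \<subseteq> B" if Z: "Z \<subseteq> E" "circuit f Z" "card Z < l" for Z
    proof -
      obtain e where e: "e \<in> Z" using Z(2) by (auto simp: circuit_def)
      then obtain B where B: "B \<in> P" "e \<in> B" using partition_onD1[OF part] Z(1) by blast
      have "h \<in> B" if "h \<in> Z" for h
        by (rule clo[OF B]) (use that e Z in \<open>auto simp: r_def\<close>)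
      then show ?thesis using B by blast
    qed
    show "\<exists>Q\<subseteq>B. joins f Q u v" if "B \<in> P" "u \<in> touched f B" "v \<in> touched f B" for B u v
    proof (cases "u = v")
      case True
      then show ?thesis using joins_empty[of f v] by (intro exI[of _ "{}"]) auto
    next
      case False
      then show ?thesis using pj[OF that] by blast
    qed
    show "\<exists>X. detour f P B u v X \<and> card X < l" if B: "B \<in> P" "u \<in> attach f P B" "v \<in> attach f P B" "u \<noteq> v" for B u v
    proof -
      have "u \<in> touched f B" "v \<in> touched f B" using B attach_touched[of f P B] by auto
      then obtain X where X: "X \<subseteq> B" "joins f X u v" "card X < l" using pj[OF B(1) _ _ B(4)] by blast
      show ?thesis using detour_of_join[OF X(1,2)] X(3) by blast
    qed
  qed
  then show ?thesis ..
qed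

end

section \<open>The incidence graph of pieces and vertices\<close>

definition packs :: "('e \<Rightarrow> 'v set) \<Rightarrow> 'e set \<Rightarrow> nat \<Rightarrow> nat \<Rightarrow> bool" where
  "packs f E l k \<longleftrightarrow> (\<exists>C::nat \<Rightarrow> 'e set. (\<forall>i<k. C i \<subseteq> E \<and> circuit f (C i) \<and> l \<le> card (C i)) \<and>
    disjoint_family_on C {..<k})"

text \<open>The edges of the incidence graph are the incident pairs themselves, with
  \<open>inc_ends\<close> in the role of \<open>f\<close>, so that the theory of even sets applies
  to it as well.\<close>

definition inc_edges :: "('e \<Rightarrow> 'v set) \<Rightarrow> 'e set set \<Rightarrow> ('v \<times> 'e set) set" where
  "inc_edges f P = {(v, B). B \<in> P \<and> v \<in> attach f P B}"

fun inc_ends :: "'v \<times> 'e set \<Rightarrow> ('v + 'e set) set" where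
  "inc_ends (v, B) = {Inl v, Inr B}"

lemma deg_inc_vertex: "deg inc_ends A (Inl v) = card {B. (v, B) \<in> A}"
proof -
  have "{e \<in> A. Inl v \<in> inc_ends e} = (\<lambda>B. (v, B)) ` {B. (v, B) \<in> A}" by auto
  then show ?thesis by (simp add: deg_def card_image inj_on_def)
qed

lemma deg_inc_piece: "deg inc_ends A (Inr B) = card {v. (v, B) \<in> A}"
proof -
  have "{e \<in> A. Inr B \<in> inc_ends e} = (\<lambda>v. (v, B)) ` {v. (v, B) \<in> A}" by auto
  then show ?thesis by (simp add: deg_def card_image inj_on_def)
qed

lemma touched_inc_vertex: "Inl v \<in> touched inc_ends A \<longleftrightarrow> (\<exists>B. (v, B) \<in> A)"
  by (auto simp: touched_def) (metis inc_ends.simps insertCI)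

lemma touched_inc_piece: "Inr B \<in> touched inc_ends A \<longleftrightarrow> (\<exists>v. (v, B) \<in> A)"
  by (auto simp: touched_def) (metis inc_ends.simps insertCI)

locale pieces = loopless f E for f :: "'e \<Rightarrow> 'v set" and E +
  fixes l :: nat and P :: "'e set set"
  assumes good: "good f E l P"
begin

lemma part: "partition_on E P"
  and short: "B \<in> P \<Longrightarrow> Z \<subseteq> B \<Longrightarrow> circuit f Z \<Longrightarrow> card Z < l"
  and local: "Z \<subseteq> E \<Longrightarrow> circuit f Z \<Longrightarrow> card Z < l \<Longrightarrow> \<exists>B\<in>P. Z \<subseteq> B"
  and conn: "B \<in> P \<Longrightarrow> u \<in> touched f B \<Longrightarrow> v \<in> touched f B \<Longrightarrow> \<exists>Q\<subseteq>B. joins f Q u v"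
  and detour_ex: "B \<in> P \<Longrightarrow> u \<in> attach f P B \<Longrightarrow> v \<in> attach f P B \<Longrightarrow> u \<noteq> v \<Longrightarrow>
    \<exists>X. detour f P B u v X \<and> card X < l"
  using good unfolding good_def by blast+

lemma PE: "B \<in> P \<Longrightarrow> B \<subseteq> E"
  using partition_onD1[OF part] by blast

lemma fP: "finite P"
  using fin PE by (meson Pow_iff finite_Pow_iff finite_subset subsetI)

lemma fB: "B \<in> P \<Longrightarrow> finite B"
  using PE finsub by blast

lemma dis: "X \<in> P \<Longrightarrow> Y \<in> P \<Longrightarrow> X \<noteq> Y \<Longrightarrow> X \<inter> Y = {}"
  using partition_onD2[OF part] by (auto simp: pairwise_def disjnt_def)

lemma piece_of: "e \<in> E \<Longrightarrow> \<exists>B\<in>P. e \<in> B"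
  using partition_onD1[OF part] by blast

lemma fattach: "B \<in> P \<Longrightarrow> finite (attach f P B)"
  using finite_touched[OF PE] attach_touched finite_subset by metis

text \<open>The degree of \<open>v\<close> is the sum of its degrees within the pieces. Hence
  changing a set inside the pieces without changing its odd vertices there preserves
  evenness.\<close>

lemma odds_by_pieces:
  assumes "W \<subseteq> E" shows "v \<in> odds f W \<longleftrightarrow> odd (card {B \<in> P. v \<in> odds f (W \<inter> B)})"
proof -
  have "{e \<in> W. v \<in> f e} = (\<Union>B\<in>P. {e \<in> W \<inter> B. v \<in> f e})"
    using assms piece_of by fastforce
  then have "deg f W v = card (\<Union>B\<in>P. {e \<in> W \<inter> B. v \<in> f e})" by (simp add: deg_def)
  also have "\<dots> = (\<Sum>B\<in>P. deg f (W \<inter> B) v)"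
    unfolding deg_def
  proof (rule card_UN_disjoint[OF fP])
    show "\<forall>B\<in>P. finite {e \<in> W \<inter> B. v \<in> f e}" using fB by simp
    show "\<forall>B\<in>P. \<forall>B'\<in>P. B \<noteq> B' \<longrightarrow> {e \<in> W \<inter> B. v \<in> f e} \<inter> {e \<in> W \<inter> B'. v \<in> f e} = {}"
      using dis by fastforce
  qed
  finally show ?thesis using even_sum_iff[OF fP, of "\<lambda>B. deg f (W \<inter> B) v"] by (simp add: odds_def)
qed

text \<open>Short circuits are split off from \<open>W\<close> one by one. Each lies in a single
  piece, so the odd vertices of \<open>W \<inter> B\<close> never change and \<open>W\<close> cannot
  become empty; a long circuit must turn up. Rerouted sets therefore need only be even and cross
  some piece.\<close>

lemma crossing_long:
  assumes "W \<subseteq> E" "odds f W = {}" "B \<in> P" "odds f (W \<inter> B) \<noteq> {}"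
  shows "\<exists>C\<subseteq>W. circuit f C \<and> l \<le> card C"
  using assms
proof (induction "card W" arbitrary: W rule: less_induct)
  case less
  have fW: "finite W" using less.prems(1) finsub by blast
  have "W \<noteq> {}" using less.prems(4) by auto
  then obtain C where C: "C \<subseteq> W" "circuit f C" using circuit_in_even[OF less.prems(1,2)] by blast
  have Cne: "C \<noteq> {}" "odds f C = {}" using C(2) by (auto simp: circuit_def)
  show ?case
  proof (cases "l \<le> card C")
    case True
    then show ?thesis using C by blast
  next
    case False
    then obtain B' where B': "B' \<in> P" "C \<subseteq> B'" using local[of C] C less.prems(1) by (meson not_le order_trans)
    have "card (W - C) < card W" using C(1) Cne(1) fW by (intro psubset_card_mono) auto
    moreover have "odds f (W - C) = {}" using odds_Diff[OF fW C(1), of f] less.prems(2) Cne by simp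
    moreover have "odds f ((W - C) \<inter> B) = odds f (W \<inter> B)"
    proof (cases "B' = B")
      case True
      then have "C \<subseteq> W \<inter> B" "(W - C) \<inter> B = W \<inter> B - C" using C B' by auto
      then show ?thesis using odds_Diff[of "W \<inter> B" C f] fW Cne by simp
    next
      case False
      then have "(W - C) \<inter> B = W \<inter> B" using dis[OF B'(1) less.prems(3)] B' by auto
      then show ?thesis by simp
    qed
    ultimately obtain C' where "C' \<subseteq> W - C" "circuit f C'" "l \<le> card C'"
      using less.hyps[of "W - C"] less.prems by auto
    then show ?thesis by blast
  qed
qed

lemma long_crosses:
  assumes D: "D \<subseteq> E" "circuit f D" "l \<le> card D" and B: "B \<in> P" "D \<inter> B \<noteq> {}"
  shows "odds f (D \<inter> B) \<noteq> {}"
proof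
  assume "odds f (D \<inter> B) = {}"
  then have "D \<inter> B = D" using D(2) B(2) unfolding circuit_def by (metis Int_lower1)
  then show False using short[OF B(1), of D] D by auto
qed

lemma packs_of_crossing:
  assumes "\<And>i. i < k \<Longrightarrow> W i \<subseteq> E \<and> odds f (W i) = {} \<and> (\<exists>B\<in>P. odds f (W i \<inter> B) \<noteq> {})"
    and "disjoint_family_on W {..<k}"
  shows "packs f E l k"
proof -
  have "\<forall>i\<in>{..<k}. \<exists>C. C \<subseteq> W i \<and> circuit f C \<and> l \<le> card C"
  proof
    fix i assume "i \<in> {..<k}"
    then obtain B where "W i \<subseteq> E" "odds f (W i) = {}" "B \<in> P" "odds f (W i \<inter> B) \<noteq> {}" using assms(1) by blast
    then show "\<exists>C. C \<subseteq> W i \<and> circuit f C \<and> l \<le> card C" by (rule crossing_long)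
  qed
  from bchoice[OF this] obtain C where C: "\<forall>i\<in>{..<k}. C i \<subseteq> W i \<and> circuit f (C i) \<and> l \<le> card (C i)" ..
  have "disjoint_family_on C {..<k}"
    using C assms(2) unfolding disjoint_family_on_def by blast
  moreover have "C i \<subseteq> E" if "i < k" for i using C assms(1)[OF that] that by blast
  ultimately show ?thesis using C unfolding packs_def by (intro exI[of _ C]) simp
qed

lemma loopless_inc: "loopless inc_ends (inc_edges f P)"
proof
  have "inc_edges f P \<subseteq> (\<Union>B\<in>P. attach f P B \<times> {B})" by (auto simp: inc_edges_def)
  moreover have "finite (\<Union>B\<in>P. attach f P B \<times> {B})" using fP fattach by auto
  ultimately show "finite (inc_edges f P)" by (rule finite_subset)
  show "card (inc_ends e) = 2" if "e \<in> inc_edges f P" for e by (cases e) auto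
qed

sublocale I: loopless inc_ends "inc_edges f P" by (rule loopless_inc)

lemma inc_pieces: "Z \<subseteq> inc_edges f P \<Longrightarrow> finite {B. Inr B \<in> touched inc_ends Z} \<and> {B. Inr B \<in> touched inc_ends Z} \<subseteq> P"
  using fP unfolding touched_inc_piece by (auto simp: inc_edges_def intro: finite_subset[OF _ fP])

text \<open>
  A circuit \<open>Z\<close> of the incidence graph is a potential further long circuit of the graph: it gains one
  join per piece that it visits once the detours of these pieces are deleted.
\<close>

lemma incidence_circuit_gain:
  assumes Z: "Z \<subseteq> inc_edges f P" "circuit inc_ends Z" and l: "0 < l"
  shows "\<exists>F\<subseteq>E. card F \<le> card {B. Inr B \<in> touched inc_ends Z} * (l - 1) \<and>
    (\<forall>k. packs f (E - F) l k \<longrightarrow> packs f E l (Suc k))"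
proof -
  define Q where "Q = {B. Inr B \<in> touched inc_ends Z}"
  have QP: "Q \<subseteq> P" and fQ: "finite Q" using inc_pieces[OF Z(1)] by (auto simp: Q_def)
  have "\<forall>B\<in>Q. \<exists>t. fst t \<noteq> fst (snd t) \<and> {v. (v, B) \<in> Z} = {fst t, fst (snd t)} \<and>
    detour f P B (fst t) (fst (snd t)) (snd (snd t)) \<and> card (snd (snd t)) < l"
  proof
    fix B assume B: "B \<in> Q"
    then have "deg inc_ends Z (Inr B) = 2" using I.circuit_deg_two[OF Z] by (simp add: Q_def)
    then obtain u v where uv: "{v. (v, B) \<in> Z} = {u, v}" "u \<noteq> v" unfolding deg_inc_piece card_2_iff by blast
    then have "(u, B) \<in> Z" "(v, B) \<in> Z" by auto
    then have "u \<in> attach f P B" "v \<in> attach f P B" using Z(1) by (auto simp: inc_edges_def)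
    then obtain X where "detour f P B u v X" "card X < l" using detour_ex[of B u v] B QP uv(2) by blast
    then show "\<exists>t. fst t \<noteq> fst (snd t) \<and> {v. (v, B) \<in> Z} = {fst t, fst (snd t)} \<and>
      detour f P B (fst t) (fst (snd t)) (snd (snd t)) \<and> card (snd (snd t)) < l"
      using uv by (intro exI[of _ "(u, v, X)"]) simp
  qed
  from bchoice[OF this] obtain t where t: "\<forall>B\<in>Q. fst (t B) \<noteq> fst (snd (t B)) \<and> {v. (v, B) \<in> Z} = {fst (t B), fst (snd (t B))} \<and>
    detour f P B (fst (t B)) (fst (snd (t B))) (snd (snd (t B))) \<and> card (snd (snd (t B))) < l" ..
  define a b X where "a B = fst (t B)" and "b B = fst (snd (t B))" and "X B = snd (snd (t B))" for B
  have ab: "a B \<noteq> b B" "{v. (v, B) \<in> Z} = {a B, b B}" "detour f P B (a B) (b B) (X B)" "card (X B) < l"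
    if "B \<in> Q" for B
    using t that by (auto simp: a_def b_def X_def)
  have XB: "X B \<subseteq> B" if "B \<in> Q" for B using ab(3)[OF that] by (auto simp: detour_def)
  define F where "F = (\<Union>B\<in>Q. X B)"
  have FE: "F \<subseteq> E" unfolding F_def using XB QP PE by (meson UN_least order_trans subsetD)
  have "card F \<le> (\<Sum>B\<in>Q. card (X B))" unfolding F_def by (rule card_UN_le[OF fQ])
  also have "\<dots> \<le> (\<Sum>B\<in>Q. l - 1)" using ab(4) by (intro sum_mono) fastforce
  finally have cF: "card F \<le> card Q * (l - 1)" by simp
  have "packs f E l (Suc k)" if pk: "packs f (E - F) l k" for k
  proof -
    obtain D where D: "\<And>i. i < k \<Longrightarrow> D i \<subseteq> E - F \<and> circuit f (D i) \<and> l \<le> card (D i)"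
      and disD: "disjoint_family_on D {..<k}" using pk unfolding packs_def by blast
    \<comment> \<open>\<open>N\<close> collects the pieces on \<open>Z\<close> without further
      attachments, the only ones where circuits are rerouted; \<open>J B\<close> holds the indices
      of the circuits that cross \<open>B\<close> from \<open>a B\<close> to
      \<open>b B\<close>.\<close>
    define N where "N = {B \<in> Q. attach f P B = {a B, b B}}"
    define J where "J B = {i. i < k \<and> odds f (D i \<inter> B) = {a B, b B}}" for B
    have DB: "odds f (D i \<inter> B) \<subseteq> attach f P B" if "i < k" "B \<in> P" for i B
      by (rule odds_piece[OF part that(2)]) (use D[OF that(1)] in \<open>auto simp: circuit_def\<close>)
    have DX: "D i \<inter> B \<subseteq> B - X B" if "i < k" "B \<in> Q" for i B
      using D[OF that(1)] that(2) by (auto simp: F_def)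
    have "\<forall>B\<in>N. \<exists>R. disjoint_family_on R (insert k (J B)) \<and> (\<forall>i\<in>insert k (J B). R i \<subseteq> B \<and> odds f (R i) = {a B, b B})"
    proof
      fix B assume B: "B \<in> N"
      then have BQ: "B \<in> Q" "attach f P B = {a B, b B}" by (auto simp: N_def)
      have "disjoint_family_on (\<lambda>i. D i \<inter> B) (J B)"
        using disD unfolding disjoint_family_on_def J_def by blast
      moreover have "\<forall>i\<in>J B. D i \<inter> B \<subseteq> B - X B \<and> joins f (D i \<inter> B) (a B) (b B)"
        using DX BQ(1) ab(1)[OF BQ(1)] by (auto simp: J_def joins_ne)
      ultimately have "joinable f (B - X B) (a B) (b B) (J B)" unfolding joinable_def by blast
      moreover have "finite (J B)" "k \<notin> J B" by (auto simp: J_def)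
      ultimately have "joinable f B (a B) (b B) (insert k (J B))"
        using ab(3)[OF BQ(1)] BQ(2) unfolding detour_def by simp
      then show "\<exists>R. disjoint_family_on R (insert k (J B)) \<and> (\<forall>i\<in>insert k (J B). R i \<subseteq> B \<and> odds f (R i) = {a B, b B})"
        using ab(1)[OF BQ(1)] unfolding joinable_def by (simp add: joins_ne)
    qed
    from bchoice[OF this] obtain R where R: "\<forall>B\<in>N. disjoint_family_on (R B) (insert k (J B)) \<and>
      (\<forall>i\<in>insert k (J B). R B i \<subseteq> B \<and> odds f (R B i) = {a B, b B})" ..
    \<comment> \<open>The new routing, with index \<open>k\<close> for the additional circuit.
      Inside a piece of \<open>N\<close> each crossing circuit gets one join of the enlarged family,
      and every other circuit gives up its edges, as its part there is even. Elsewhere the circuits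
      keep their parts, which avoid the deleted \<open>X B\<close>, and \<open>X B\<close> becomes
      the join of the additional circuit.\<close>
    define p where "p i B = (if B \<in> N then if i = k \<or> i \<in> J B then R B i else {}
      else if i < k then D i \<inter> B else if B \<in> Q then X B else {})" for i B
    have pB: "p i B \<subseteq> B" if "B \<in> P" for i B
      using R XB that by (auto simp: p_def)
    have po: "odds f (p i B) = odds f (D i \<inter> B)" if i: "i < k" and B: "B \<in> P" for i B
    proof (cases "B \<in> N \<and> i \<notin> J B")
      case True
      then have "odds f (D i \<inter> B) \<subseteq> {a B, b B}" "odds f (D i \<inter> B) \<noteq> {a B, b B}"
        using DB[OF i B] i by (auto simp: N_def J_def)
      then have "odds f (D i \<inter> B) = {}" using odds_sub_pair[of "D i \<inter> B"] PE[OF B] by blast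
      then show ?thesis using True i by (simp add: p_def)
    next
      case False
      then show ?thesis using R i by (auto simp: p_def J_def)
    qed
    have pk': "odds f (p k B) = {v. (v, B) \<in> Z}" if B: "B \<in> P" for B
    proof (cases "B \<in> Q")
      case True
      show ?thesis
      proof (cases "B \<in> N")
        case True
        then show ?thesis using R ab(2)[OF \<open>B \<in> Q\<close>] by (simp add: p_def)
      next
        case False
        then have "joins f (X B) (a B) (b B)" using ab(3)[OF True] True by (simp add: detour_def N_def)
        then show ?thesis using False True ab(1,2)[OF True] by (simp add: p_def joins_ne)
      qed
    next
      case False
      then have "{v. (v, B) \<in> Z} = {}" by (auto simp: Q_def touched_inc_piece)
      then show ?thesis using False by (simp add: p_def N_def)
    qed
    have pd: "p i B \<inter> p j B = {}" if ij: "i < Suc k" "j < Suc k" "i \<noteq> j" and B: "B \<in> P" for i j B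
    proof (cases "B \<in> N")
      case True
      show ?thesis
      proof (cases "i \<in> insert k (J B) \<and> j \<in> insert k (J B)")
        case both: True
        have "disjoint_family_on (R B) (insert k (J B))" using R True by blast
        then have "R B i \<inter> R B j = {}" using both ij(3) unfolding disjoint_family_on_def by blast
        then show ?thesis using True both by (simp add: p_def)
      next
        case False
        then have "p i B = {} \<or> p j B = {}" using True by (auto simp: p_def)
        then show ?thesis by blast
      qed
    next
      case False
      show ?thesis
      proof (cases "i < k \<and> j < k")
        case True
        then have "D i \<inter> D j = {}" using disD ij(3) unfolding disjoint_family_on_def by blast
        then show ?thesis using False True by (auto simp: p_def)
      next
        case nb: False
        then have "(i = k \<and> j < k) \<or> (j = k \<and> i < k)" using ij by auto
        then show ?thesis
          using False DX[of i B] DX[of j B] by (auto simp: p_def)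
      qed
    qed
    define W where "W i = (\<Union>B\<in>P. p i B)" for i
    have WE: "W i \<subseteq> E" for i using pB PE unfolding W_def by blast
    have WB: "W i \<inter> B = p i B" if B: "B \<in> P" for i B
    proof
      show "p i B \<subseteq> W i \<inter> B" using pB[OF B] B by (auto simp: W_def)
      show "W i \<inter> B \<subseteq> p i B"
      proof
        fix e assume e: "e \<in> W i \<inter> B"
        then obtain B' where B': "B' \<in> P" "e \<in> p i B'" by (auto simp: W_def)
        then have "e \<in> B'" using pB by blast
        then have "B' = B" using dis[OF B'(1) B] e by blast
        then show "e \<in> p i B" using B' by simp
      qed
    qed
    have crossD: "\<exists>B\<in>P. odds f (D i \<inter> B) \<noteq> {}" if i: "i < k" for i
    proof -
      obtain e where e: "e \<in> D i" using D[OF i] by (auto simp: circuit_def)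
      then obtain B where B: "B \<in> P" "e \<in> B" using piece_of D[OF i] by blast
      have "odds f (D i \<inter> B) \<noteq> {}"
        by (rule long_crosses) (use D[OF i] B e in auto)
      then show ?thesis using B by blast
    qed
    have "odds f (W i) = {} \<and> (\<exists>B\<in>P. odds f (W i \<inter> B) \<noteq> {})" if i: "i < Suc k" for i
    proof (cases "i < k")
      case True
      have eq: "odds f (W i \<inter> B) = odds f (D i \<inter> B)" if "B \<in> P" for B using WB[OF that] po[OF True that] by simp
      have "D i \<subseteq> E" "odds f (D i) = {}" using D[OF True] by (auto simp: circuit_def)
      moreover have "{B \<in> P. v \<in> odds f (W i \<inter> B)} = {B \<in> P. v \<in> odds f (D i \<inter> B)}" for v using eq by auto
      ultimately have "odds f (W i) = {}" using odds_by_pieces[OF WE] odds_by_pieces[of "D i"] by auto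
      then show ?thesis using crossD[OF True] eq by auto
    next
      case False
      then have ik: "i = k" using i by simp
      have eq: "odds f (W i \<inter> B) = {v. (v, B) \<in> Z}" if "B \<in> P" for B using WB[OF that] pk'[OF that] ik by simp
      \<comment> \<open>The pieces in which \<open>v\<close> is odd are those incident with
        \<open>v\<close> in \<open>Z\<close>, and their number is the degree of \<open>v\<close> in
        the circuit \<open>Z\<close>.\<close>
      have "v \<notin> odds f (W i)" for v
      proof -
        have "{B \<in> P. v \<in> odds f (W i \<inter> B)} = {B. (v, B) \<in> Z}"
          using eq Z(1) by (auto simp: inc_edges_def)
        moreover have "even (deg inc_ends Z (Inl v))" using Z(2) by (auto simp: circuit_def odds_def)
        ultimately show ?thesis using odds_by_pieces[OF WE] by (simp add: deg_inc_vertex)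
      qed
      moreover obtain v B where vB: "(v, B) \<in> Z" using Z(2) by (auto simp: circuit_def)
      moreover have "B \<in> P" using vB Z(1) by (auto simp: inc_edges_def)
      ultimately show ?thesis using eq by blast
    qed
    moreover have "disjoint_family_on W {..<Suc k}"
      unfolding disjoint_family_on_def
    proof (intro ballI impI)
      fix i j assume ij: "i \<in> {..<Suc k}" "j \<in> {..<Suc k}" "i \<noteq> j"
      show "W i \<inter> W j = {}"
      proof (rule ccontr)
        assume "W i \<inter> W j \<noteq> {}"
        then obtain e where e: "e \<in> W i" "e \<in> W j" by blast
        then obtain B where B: "B \<in> P" "e \<in> B" using piece_of WE by blast
        then have "e \<in> p i B \<inter> p j B" using e WB by blast
        then show False using pd[of i j B] ij B by auto
      qed
    qed
    ultimately show ?thesis using packs_of_crossing[of "Suc k" W] WE by blast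
  qed
  then show ?thesis using FE cF unfolding Q_def by blast
qed

end

section \<open>Packing and covering\<close>

text \<open>Both assumptions shape the incidence graph. \<open>covered\<close> is achieved by
  discarding the edges on no long circuit and gives every piece two attachments, hence minimum
  degree 2; \<open>minimal\<close> excludes pieces in series that could be merged.\<close>

locale minimal_pieces = pieces +
  assumes covered: "e \<in> E \<Longrightarrow> \<exists>D\<subseteq>E. circuit f D \<and> l \<le> card D \<and> e \<in> D"
    and minimal: "good f E l P' \<Longrightarrow> card P \<le> card P'"
begin

text \<open>A long circuit through an edge of \<open>B\<close> leaves \<open>B\<close>, so its part
  in \<open>B\<close> has a positive even number of odd vertices, all of them attachments.\<close>

lemma attach_two: assumes B: "B \<in> P" shows "2 \<le> card (attach f P B)"
proof -
  obtain e where e: "e \<in> B" using partition_onD3[OF part] B by (metis all_not_in_conv)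
  then obtain D where D: "D \<subseteq> E" "circuit f D" "l \<le> card D" "e \<in> D" using covered[of e] PE[OF B] by blast
  have "odds f (D \<inter> B) \<noteq> {}" by (rule long_crosses) (use D B e in auto)
  moreover have DBE: "D \<inter> B \<subseteq> E" using D by blast
  moreover have "finite (odds f (D \<inter> B))" using finite_odds[OF DBE] .
  ultimately have "card (odds f (D \<inter> B)) \<noteq> 0" by simp
  then have "2 \<le> card (odds f (D \<inter> B))" using dvd_imp_le[OF handshake[OF DBE]] by simp
  also have "\<dots> \<le> card (attach f P B)"
    by (rule card_mono[OF fattach[OF B]], rule odds_piece[OF part B]) (use D in \<open>auto simp: circuit_def\<close>)
  finally show ?thesis .
qed

lemma deg_piece: "B \<in> P \<Longrightarrow> deg inc_ends (inc_edges f P) (Inr B) = card (attach f P B)"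
  unfolding deg_inc_piece by (simp add: inc_edges_def)

lemma inc_vertex_pieces: "(v, B) \<in> inc_edges f P \<Longrightarrow> {C. (v, C) \<in> inc_edges f P} = {C \<in> P. v \<in> touched f C}"
  by (auto simp: inc_edges_def attach_def)

lemma inc_min_degree:
  assumes "z \<in> touched inc_ends (inc_edges f P)"
  shows "2 \<le> deg inc_ends (inc_edges f P) z"
proof (cases z)
  case (Inl v)
  then have "\<exists>B. (v, B) \<in> inc_edges f P" using assms by (simp only: touched_inc_vertex)
  then obtain B where B: "(v, B) \<in> inc_edges f P" ..
  then obtain C where C: "B \<in> P" "C \<in> P" "C \<noteq> B" "v \<in> touched f B" "v \<in> touched f C"
    by (auto simp: inc_edges_def attach_def)
  have "card {B, C} \<le> card {C. (v, C) \<in> inc_edges f P}"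
    unfolding inc_vertex_pieces[OF B] using C fP by (intro card_mono) auto
  then show ?thesis using C(3) Inl by (simp add: deg_inc_vertex)
next
  case (Inr B)
  then have "B \<in> P" using assms by (auto simp: touched_inc_piece inc_edges_def)
  then show ?thesis using deg_piece attach_two Inr by simp
qed

lemma touched_inc: "touched inc_ends (inc_edges f P) = Inl ` (\<Union>B\<in>P. attach f P B) \<union> Inr ` P"
proof (intro set_eqI iffI)
  fix z assume z: "z \<in> touched inc_ends (inc_edges f P)"
  show "z \<in> Inl ` (\<Union>B\<in>P. attach f P B) \<union> Inr ` P"
    using z by (cases z) (auto simp: touched_inc_vertex touched_inc_piece inc_edges_def)
next
  fix z assume z: "z \<in> Inl ` (\<Union>B\<in>P. attach f P B) \<union> Inr ` P"
  show "z \<in> touched inc_ends (inc_edges f P)"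
  proof (cases z)
    case (Inl v)
    then show ?thesis using z by (auto simp: touched_inc_vertex inc_edges_def)
  next
    case (Inr B)
    then have B: "B \<in> P" using z by auto
    then have "attach f P B \<noteq> {}" using attach_two by fastforce
    then show ?thesis using Inr B by (auto simp: touched_inc_piece inc_edges_def)
  qed
qed

text \<open>
  The union of spanning trees of the pieces has the same excess of edges over vertices as the
  incidence graph, and all its circuits are long.
\<close>

lemma packs_of_excess:
  assumes "card (touched inc_ends (inc_edges f P)) + 8 * k\<^sup>2 \<le> card (inc_edges f P)"
  shows "packs f E l k"
proof -
  have "\<forall>B\<in>P. \<exists>T. T \<subseteq> B \<and> forest f T \<and> touched f T = touched f B \<and> card (touched f B) \<le> card T + 1"
  proof
    fix B assume B: "B \<in> P"
    then have "B \<noteq> {}" using partition_onD3[OF part] by blast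
    then show "\<exists>T. T \<subseteq> B \<and> forest f T \<and> touched f T = touched f B \<and> card (touched f B) \<le> card T + 1"
      using spanning_tree[OF PE[OF B] _ conn[OF B]] by blast
  qed
  from bchoice[OF this] obtain T where "\<forall>B\<in>P. T B \<subseteq> B \<and> forest f (T B) \<and> touched f (T B) = touched f B \<and>
    card (touched f B) \<le> card (T B) + 1" ..
  then have T: "T B \<subseteq> B" "forest f (T B)" "touched f (T B) = touched f B" "card (touched f B) \<le> card (T B) + 1"
    if "B \<in> P" for B using that by auto
  define H where "H = (\<Union>B\<in>P. T B)"
  define V where "V = (\<Union>B\<in>P. attach f P B)"
  have HE: "H \<subseteq> E" using T(1) PE unfolding H_def by blast
  have fV: "finite V" using fP fattach by (simp add: V_def)
  have ft: "finite (touched f B)" if "B \<in> P" for B using finite_touched[OF PE[OF that]] .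
  have "card H = (\<Sum>B\<in>P. card (T B))"
    unfolding H_def
  proof (rule card_UN_disjoint[OF fP])
    show "\<forall>B\<in>P. finite (T B)" using T(1) fB finite_subset by metis
    show "\<forall>B\<in>P. \<forall>C\<in>P. B \<noteq> C \<longrightarrow> T B \<inter> T C = {}"
    proof (intro ballI impI)
      fix B C assume "B \<in> P" "C \<in> P" "B \<noteq> C"
      then show "T B \<inter> T C = {}" using T(1)[of B] T(1)[of C] dis[of B C] by blast
    qed
  qed
  moreover have "card (inc_edges f P) = (\<Sum>B\<in>P. card (attach f P B))"
  proof -
    have "inc_edges f P = (\<lambda>(B, v). (v, B)) ` (SIGMA B:P. attach f P B)" by (auto simp: inc_edges_def image_iff)
    then have "card (inc_edges f P) = card (SIGMA B:P. attach f P B)"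
      by (simp add: card_image inj_on_def split_beta prod_eq_iff)
    then show ?thesis using fP fattach by (simp add: card_SigmaI)
  qed
  moreover have "card (touched inc_ends (inc_edges f P)) = card V + card P"
    unfolding touched_inc V_def[symmetric] using fV fP
    by (subst card_Un_disjoint) (auto simp: card_image)
  moreover have "card (touched f H) \<le> card V + (\<Sum>B\<in>P. card (touched f B - attach f P B))"
  proof -
    have "touched f H \<subseteq> V \<union> (\<Union>B\<in>P. touched f B - attach f P B)"
      using T(1) by (fastforce simp: H_def V_def touched_def)
    then have "card (touched f H) \<le> card (V \<union> (\<Union>B\<in>P. touched f B - attach f P B))"
      using fV fP ft by (intro card_mono) auto
    also have "\<dots> \<le> card V + card (\<Union>B\<in>P. touched f B - attach f P B)" by (rule card_Un_le)
    also have "\<dots> \<le> card V + (\<Sum>B\<in>P. card (touched f B - attach f P B))"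
      using card_UN_le[OF fP] by (rule add_left_mono)
    finally show ?thesis .
  qed
  \<comment> \<open>Each tree has at most one edge less than vertices; the total loss
    \<open>card P\<close> is matched by the piece vertices of the incidence graph.\<close>
  moreover have "(\<Sum>B\<in>P. card (touched f B - attach f P B)) + (\<Sum>B\<in>P. card (attach f P B)) \<le> (\<Sum>B\<in>P. card (T B)) + card P"
  proof -
    have "(\<Sum>B\<in>P. card (touched f B - attach f P B)) + (\<Sum>B\<in>P. card (attach f P B))
        = (\<Sum>B\<in>P. card (touched f B - attach f P B) + card (attach f P B))" by (simp add: sum.distrib)
    also have "\<dots> \<le> (\<Sum>B\<in>P. card (T B) + 1)"
    proof (rule sum_mono)
      fix B assume B: "B \<in> P"
      have "card (touched f B - attach f P B) + card (attach f P B) = card (touched f B)"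
        using attach_touched[of f P B] ft[OF B] fattach[OF B] by (simp add: card_Diff_subset card_mono)
      then show "card (touched f B - attach f P B) + card (attach f P B) \<le> card (T B) + 1" using T(4)[OF B] by simp
    qed
    also have "\<dots> = (\<Sum>B\<in>P. card (T B)) + card P"
      by (simp only: sum.distrib sum_constant mult_1_right of_nat_id)
    finally show ?thesis .
  qed
  ultimately have "card (touched f H) + 8 * k\<^sup>2 \<le> card H" using assms by linarith
  then obtain C where C: "\<forall>i<k. C i \<subseteq> H \<and> circuit f (C i)" "disjoint_family_on C {..<k}"
    using excess_packing[OF sub[OF HE]] by blast
  \<comment> \<open>A short circuit would lie in one piece and so in its spanning tree.\<close>
  have "l \<le> card (C i)" if i: "i < k" for i
  proof (rule ccontr)
    assume "\<not> l \<le> card (C i)"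
    then obtain B where B: "B \<in> P" "C i \<subseteq> B" using local[of "C i"] C(1) i HE by (meson not_le order_trans)
    have "C i \<subseteq> T B"
    proof
      fix e assume e: "e \<in> C i"
      then obtain B' where B': "B' \<in> P" "e \<in> T B'" using C(1) i by (auto simp: H_def)
      have "B' = B" using dis[OF B'(1) B(1)] T(1)[OF B'(1)] B'(2) B(2) e by blast
      then show "e \<in> T B" using B' by simp
    qed
    moreover have "circuit f (C i)" using C(1) i by simp
    ultimately show False using T(2)[OF B(1)] unfolding forest_def circuit_def by metis
  qed
  then show ?thesis using C HE unfolding packs_def by blast
qed

text \<open>Merging contradicts minimality unless both pieces have the same two attachments; then
  they are parallel and form a circuit of the incidence graph themselves.\<close>

lemma no_series_pair:
  assumes B: "B1 \<in> P" "B2 \<in> P" "B1 \<noteq> B2" and at: "attach f P B1 = {u, v}" "attach f P B2 = {v, w}"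
    and ne: "u \<noteq> v" "v \<noteq> w" and only: "{B \<in> P. v \<in> touched f B} = {B1, B2}"
  shows "u = w"
proof (rule ccontr)
  assume "u \<noteq> w"
  then have "good f E l (insert (B1 \<union> B2) (P - {B1, B2}))"
    using good_merge[OF good B at ne] only by blast
  then have "card P \<le> card (insert (B1 \<union> B2) (P - {B1, B2}))" by (rule minimal)
  also have "\<dots> \<le> Suc (card (P - {B1, B2}))" using fP by (simp add: card_insert_if)
  also have "card (P - {B1, B2}) = card P - 2" using B fP by (simp add: card_Diff_subset)
  finally have "card P \<le> Suc (card P - 2)" .
  moreover have "card {B1, B2} \<le> card P" using B fP by (intro card_mono) auto
  ultimately show False using B(3) by simp
qed

text \<open>A circuit alternates between vertices and pieces, so it suffices to bound its vertices.
  A vertex of degree 2 both of whose pieces have only two attachments would give a series pair;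
  hence each vertex of the circuit branches or is next to a branching piece of the circuit. At most
  \<open>4 * L\<close> nodes of the circuit branch and each accounts for at most two vertices, which
  gives \<open>8 * L\<close>.\<close>

lemma short_incidence_circuit:
  assumes L: "0 < L" and E: "E \<noteq> {}"
    and sparse: "card {z \<in> touched inc_ends (inc_edges f P). 3 \<le> deg inc_ends (inc_edges f P) z} < 2 ^ (2 * L)"
  shows "\<exists>Z\<subseteq>inc_edges f P. circuit inc_ends Z \<and> card {B. Inr B \<in> touched inc_ends Z} \<le> 8 * L"
proof (cases "\<exists>B1\<in>P. \<exists>B2\<in>P. \<exists>u v. B1 \<noteq> B2 \<and> u \<noteq> v \<and> attach f P B1 = {u, v} \<and> attach f P B2 = {u, v}")
  case True
  then obtain B1 B2 u v where B: "B1 \<in> P" "B2 \<in> P" "B1 \<noteq> B2" "u \<noteq> v" "attach f P B1 = {u, v}" "attach f P B2 = {u, v}"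
    by blast
  \<comment> \<open>Parallel pieces resist merging in series, but their four incidences form an even
    set that visits only two pieces.\<close>
  define W where "W = {(u, B1), (v, B1), (u, B2), (v, B2)}"
  have WI: "W \<subseteq> inc_edges f P" using B by (auto simp: W_def inc_edges_def)
  have "even (deg inc_ends W z)" for z
  proof (cases z)
    case (Inl x)
    have "{C. (x, C) \<in> W} = (if x = u \<or> x = v then {B1, B2} else {})" using B(3,4) by (auto simp: W_def)
    then show ?thesis using Inl B(3) by (simp add: deg_inc_vertex)
  next
    case (Inr C)
    have "{x. (x, C) \<in> W} = (if C = B1 \<or> C = B2 then {u, v} else {})" using B(3,4) by (auto simp: W_def)
    then show ?thesis using Inr B(4) by (simp add: deg_inc_piece)
  qed
  then have "odds inc_ends W = {}" by (simp add: odds_def)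
  moreover have "(u, B1) \<in> W" by (simp add: W_def)
  ultimately obtain Z where Z: "Z \<subseteq> W" "circuit inc_ends Z" using I.circuit_in_even[OF WI] by blast
  have "{B. Inr B \<in> touched inc_ends Z} \<subseteq> {B1, B2}" using Z(1) by (auto simp: touched_inc_piece W_def)
  then have "card {B. Inr B \<in> touched inc_ends Z} \<le> card {B1, B2}" by (intro card_mono) auto
  also have "\<dots> \<le> 8 * L" using L B(3) by simp
  finally show ?thesis using Z WI by blast
next
  case nopar: False
  let ?I = "inc_edges f P"
  obtain e B0 where "e \<in> E" "B0 \<in> P" "e \<in> B0" using E piece_of by blast
  then have "Inr B0 \<in> touched inc_ends ?I" by (simp add: touched_inc)
  then have "?I \<noteq> {}" by (auto simp: touched_def)
  then obtain Z0 where Z0: "Z0 \<subseteq> ?I" "Z0 \<noteq> {}" "odds inc_ends Z0 = {}"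
    "card {z \<in> touched inc_ends Z0. 3 \<le> deg inc_ends ?I z} \<le> 2 * (2 * L)"
    using few_branch_even[OF loopless_inc _ inc_min_degree sparse] by blast
  obtain Z where Z: "Z \<subseteq> Z0" "circuit inc_ends Z" using I.circuit_in_even[OF Z0(1,3)] Z0(2) by blast
  have ZI: "Z \<subseteq> ?I" using Z Z0 by blast
  have fZ: "finite (touched inc_ends Z)" using I.finite_touched[OF ZI] .
  define br where "br = {z \<in> touched inc_ends Z. 3 \<le> deg inc_ends ?I z}"
  have "br \<subseteq> {z \<in> touched inc_ends Z0. 3 \<le> deg inc_ends ?I z}" using touched_mono[OF Z(1), of inc_ends] by (auto simp: br_def)
  then have "card br \<le> card {z \<in> touched inc_ends Z0. 3 \<le> deg inc_ends ?I z}"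
    using I.finite_touched[OF Z0(1)] by (intro card_mono) auto
  then have cbr: "card br \<le> 4 * L" using Z0(4) by linarith
  define Q where "Q = {B. Inr B \<in> touched inc_ends Z}"
  define V where "V = {v. Inl v \<in> touched inc_ends Z}"
  have QP: "Q \<subseteq> P" and fQ: "finite Q" using inc_pieces[OF ZI] by (auto simp: Q_def)
  have tZ: "touched inc_ends Z = Inl ` V \<union> Inr ` Q"
  proof (intro set_eqI)
    fix z show "z \<in> touched inc_ends Z \<longleftrightarrow> z \<in> Inl ` V \<union> Inr ` Q"
      by (cases z) (auto simp: V_def Q_def)
  qed
  have fV: "finite V" using fZ unfolding tZ by (simp add: finite_image_iff)
  have dQ: "card {v. (v, B) \<in> Z} = 2" if "B \<in> Q" for B
    using I.circuit_deg_two[OF ZI Z(2), of "Inr B"] that by (simp add: Q_def deg_inc_piece)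
  have dV: "card {B. (v, B) \<in> Z} = 2" if "v \<in> V" for v
    using I.circuit_deg_two[OF ZI Z(2), of "Inl v"] that by (simp add: V_def deg_inc_vertex)
  have "card V = card Q"
  proof -
    have "card (touched inc_ends Z) = card V + card Q"
      unfolding tZ using fV fQ by (subst card_Un_disjoint) (auto simp: card_image)
    moreover have "card Z = 2 * card Q"
    proof -
      have "Z = (\<lambda>(B, v). (v, B)) ` (SIGMA B:Q. {v. (v, B) \<in> Z})"
        by (auto simp: image_iff Q_def touched_inc_piece)
      then have "card Z = card (SIGMA B:Q. {v. (v, B) \<in> Z})"
        using card_image[of "\<lambda>(B, v). (v, B)" "SIGMA B:Q. {v. (v, B) \<in> Z}"]
        by (auto simp: inj_on_def)
      also have "\<dots> = (\<Sum>B\<in>Q. card {v. (v, B) \<in> Z})"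
        using fQ dQ by (intro card_SigmaI) (auto intro: card_ge_0_finite)
      also have "\<dots> = (\<Sum>B\<in>Q. 2)" by (rule sum.cong) (use dQ in auto)
      finally show ?thesis by simp
    qed
    ultimately show ?thesis using I.circuit_card[OF ZI Z(2)] by linarith
  qed
  define bV where "bV = {v. Inl v \<in> br}"
  define bQ where "bQ = {B. Inr B \<in> br}"
  have brU: "br = Inl ` bV \<union> Inr ` bQ"
  proof (intro set_eqI)
    fix z show "z \<in> br \<longleftrightarrow> z \<in> Inl ` bV \<union> Inr ` bQ" by (cases z) (auto simp: bV_def bQ_def)
  qed
  have fbr: "finite br" using fZ by (simp add: br_def)
  then have fb: "finite bV" "finite bQ" unfolding brU by (simp_all add: finite_image_iff)
  have cb: "card br = card bV + card bQ"
    unfolding brU using fb by (subst card_Un_disjoint) (auto simp: card_image)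
  have bQQ: "bQ \<subseteq> Q" by (auto simp: bQ_def br_def Q_def)
  have cover: "v \<in> bV \<or> (\<exists>B\<in>bQ. (v, B) \<in> Z)" if v: "v \<in> V" for v
  proof (rule ccontr)
    assume n: "\<not> ?thesis"
    obtain B1 B2 where B12: "{B. (v, B) \<in> Z} = {B1, B2}" "B1 \<noteq> B2" using dV[OF v] unfolding card_2_iff by blast
    have Zs: "(v, B1) \<in> Z" "(v, B2) \<in> Z" using B12 by auto
    then have I: "(v, B1) \<in> ?I" "(v, B2) \<in> ?I" using ZI by auto
    then have BP: "B1 \<in> P" "B2 \<in> P" "v \<in> attach f P B1" "v \<in> attach f P B2" by (auto simp: inc_edges_def)
    have fin: "finite {C. (v, C) \<in> ?I}" unfolding inc_vertex_pieces[OF I(1)] using fP by simp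
    have "v \<notin> bV" using n by blast
    then have "\<not> 3 \<le> card {C. (v, C) \<in> ?I}" using v by (simp add: bV_def br_def V_def deg_inc_vertex)
    moreover have "{B1, B2} \<subseteq> {C. (v, C) \<in> ?I}" using I by auto
    ultimately have "{B1, B2} = {C. (v, C) \<in> ?I}"
      using fin B12(2) card_mono[OF fin, of "{B1, B2}"] by (intro card_subset_eq) auto
    then have only: "{B \<in> P. v \<in> touched f B} = {B1, B2}" using inc_vertex_pieces[OF I(1)] by simp
    have two: "card (attach f P B) = 2" if B: "(v, B) \<in> Z" for B
    proof -
      have "B \<in> P" using B ZI by (auto simp: inc_edges_def)
      moreover have "Inr B \<in> touched inc_ends Z" using B by (auto simp: touched_inc_piece)
      moreover have "B \<notin> bQ" using n B by blast
      ultimately have "\<not> 3 \<le> card (attach f P B)" "2 \<le> card (attach f P B)"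
        using deg_piece[of B] attach_two[of B] by (auto simp: bQ_def br_def)
      then show ?thesis by simp
    qed
    obtain u where u: "attach f P B1 = {u, v}" "u \<noteq> v"
      using two[OF Zs(1)] BP(3) unfolding card_2_iff by (metis doubleton_eq_iff insertE singletonD)
    obtain w where w: "attach f P B2 = {v, w}" "v \<noteq> w"
      using two[OF Zs(2)] BP(4) unfolding card_2_iff by (metis doubleton_eq_iff insertE singletonD)
    have "u = w" by (rule no_series_pair[OF BP(1,2) B12(2) u(1) w(1) u(2) w(2) only])
    then show False using nopar BP(1,2) B12(2) u w by (metis insert_commute)
  qed
  have "V \<subseteq> bV \<union> (\<Union>B\<in>bQ. {v. (v, B) \<in> Z})" using cover by blast
  then have "card V \<le> card (bV \<union> (\<Union>B\<in>bQ. {v. (v, B) \<in> Z}))"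
    using fb bQQ dQ by (intro card_mono) (auto intro!: card_ge_0_finite)
  also have "\<dots> \<le> card bV + card (\<Union>B\<in>bQ. {v. (v, B) \<in> Z})" by (rule card_Un_le)
  also have "\<dots> \<le> card bV + (\<Sum>B\<in>bQ. card {v. (v, B) \<in> Z})" using card_UN_le[OF fb(2)] by (rule add_left_mono)
  also have "(\<Sum>B\<in>bQ. card {v. (v, B) \<in> Z}) = (\<Sum>B\<in>bQ. 2)" by (rule sum.cong) (use dQ bQQ in auto)
  finally have "card V \<le> card bV + 2 * card bQ" by (simp add: mult.commute)
  then have "card Q \<le> 8 * L" using \<open>card V = card Q\<close> cb cbr by linarith
  then show ?thesis using ZI Z(2) unfolding Q_def by blast
qed

end

section \<open>Lowering the packing number, and the final induction\<close>

lemma packs_mono: "packs f E l k \<Longrightarrow> E \<subseteq> E' \<Longrightarrow> packs f E' l k"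
  unfolding packs_def by blast

text \<open>\<open>F\<close> is found before any packing of \<open>E - F\<close> is considered,
  which makes it valid for every \<open>j\<close>. The bound \<open>8 * L * (l - 1)\<close> is also
  the threshold up to which a long circuit is deleted as a whole.\<close>

lemma (in loopless) reduce_packing:
  assumes k: "0 < k" and l: "2 \<le> l" and L: "4 * k \<le> 2 ^ L"
    and D0: "D0 \<subseteq> E" "circuit f D0" "l \<le> card D0" and np: "\<not> packs f E l k"
  shows "\<exists>F\<subseteq>E. card F \<le> 8 * L * (l - 1) \<and> (\<forall>j. packs f (E - F) l j \<longrightarrow> packs f E l (Suc j))"
proof (cases "\<exists>Z\<subseteq>E. circuit f Z \<and> l \<le> card Z \<and> card Z \<le> 8 * L * (l - 1)")
  case True
  then obtain Z where Z: "Z \<subseteq> E" "circuit f Z" "l \<le> card Z" "card Z \<le> 8 * L * (l - 1)" by blast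
  have "packs f E l (Suc j)" if pj: "packs f (E - Z) l j" for j
  proof -
    obtain C where C: "\<forall>i<j. C i \<subseteq> E - Z \<and> circuit f (C i) \<and> l \<le> card (C i)" "disjoint_family_on C {..<j}"
      using pj unfolding packs_def by blast
    have "disjoint_family_on (C(j := Z)) {..<Suc j}"
      using C unfolding disjoint_family_on_def by (auto simp: less_Suc_eq) blast+
    moreover have "\<forall>i<Suc j. (C(j := Z)) i \<subseteq> E \<and> circuit f ((C(j := Z)) i) \<and> l \<le> card ((C(j := Z)) i)"
      using C(1) Z(1-3) by (auto simp: less_Suc_eq)
    ultimately show ?thesis unfolding packs_def by blast
  qed
  then show ?thesis using Z by blast
next
  case False
  have L2: "2 \<le> L"
  proof (rule ccontr)
    assume "\<not> 2 \<le> L"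
    then have "(2::nat) ^ L \<le> 2 ^ 1" by (intro power_increasing) auto
    then show False using L k by simp
  qed
  \<comment> \<open>All long circuits now exceed the threshold, which is at least
    \<open>2 * l\<close>; this is the gap.\<close>
  have "8 * 2 * (l - 1) \<le> 8 * L * (l - 1)" using L2 by (intro mult_le_mono) auto
  then have "2 * l \<le> 8 * L * (l - 1)" using l by linarith
  then have gap: "card Z < l \<or> 2 * l \<le> card Z" if "Z \<subseteq> E" "circuit f Z" for Z
    using False that by (meson le_trans not_le less_imp_le)
  \<comment> \<open>Edges on no long circuit do not matter for packings; without them every piece
    gets two attachments.\<close>
  define E1 where "E1 = \<Union>{D. D \<subseteq> E \<and> circuit f D \<and> l \<le> card D}"
  have E1: "E1 \<subseteq> E" by (auto simp: E1_def)
  interpret S: loopless f E1 by (rule sub[OF E1])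
  have "\<exists>P. good f E1 l P" by (rule S.good_exists[OF l]) (use gap E1 in blast)
  then obtain P0 where P0: "good f E1 l P0" ..
  have "\<exists>P. good f E1 l P \<and> (\<forall>P'. good f E1 l P' \<longrightarrow> card P \<le> card P')"
    by (rule ex_has_least_nat[of _ P0]) (rule P0)
  then obtain P where P: "good f E1 l P" "\<And>P'. good f E1 l P' \<Longrightarrow> card P \<le> card P'" by blast
  interpret M: minimal_pieces f E1 l P
  proof unfold_locales
    show "good f E1 l P" by (rule P(1))
    show "card P \<le> card P'" if "good f E1 l P'" for P' by (rule P(2)[OF that])
    show "\<exists>D\<subseteq>E1. circuit f D \<and> l \<le> card D \<and> e \<in> D" if "e \<in> E1" for e
      using that unfolding E1_def by blast
  qed
  let ?I = "inc_edges f P"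
  have "\<not> packs f E1 l k" using np packs_mono E1 by blast
  then have ex: "card ?I < card (touched inc_ends ?I) + 8 * k\<^sup>2" using M.packs_of_excess[of k] by linarith
  \<comment> \<open>An excess of at most \<open>8 * k^2 - 1\<close> allows fewer than
    \<open>16 * k^2\<close> branch vertices, and the condition \<open>4 * k\<close> \<le>
    \<open>2 ^ L\<close> makes this at most \<open>2 ^ (2 * L)\<close>.\<close>
  have "card {z \<in> touched inc_ends ?I. 3 \<le> deg inc_ends ?I z} \<le> 2 * (8 * k\<^sup>2 - 1)"
    by (rule excess_branch[OF M.loopless_inc M.inc_min_degree]) (use ex in auto)
  also have "\<dots> < 16 * k\<^sup>2" using k by simp
  also have "16 * k\<^sup>2 = (4 * k)\<^sup>2" by (simp add: power2_eq_square)
  also have "\<dots> \<le> (2 ^ L)\<^sup>2" using L by (rule power_mono) simp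
  also have "\<dots> = 2 ^ (2 * L)" by (simp add: power_mult mult.commute)
  finally have sparse: "card {z \<in> touched inc_ends ?I. 3 \<le> deg inc_ends ?I z} < 2 ^ (2 * L)" .
  have "D0 \<subseteq> E1" using D0 by (auto simp: E1_def)
  moreover have "D0 \<noteq> {}" using D0(2) by (simp add: circuit_def)
  ultimately have "E1 \<noteq> {}" by blast
  then obtain Z where Z: "Z \<subseteq> ?I" "circuit inc_ends Z" "card {B. Inr B \<in> touched inc_ends Z} \<le> 8 * L"
    using M.short_incidence_circuit[OF _ _ sparse] L2 by auto
  obtain F where F: "F \<subseteq> E1" "card F \<le> card {B. Inr B \<in> touched inc_ends Z} * (l - 1)"
    "\<And>j. packs f (E1 - F) l j \<Longrightarrow> packs f E1 l (Suc j)"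
    using M.incidence_circuit_gain[OF Z(1,2)] l by auto
  have "packs f E l (Suc j)" if pj: "packs f (E - F) l j" for j
  proof -
    have "packs f (E1 - F) l j"
    proof -
      obtain C where C: "\<forall>i<j. C i \<subseteq> E - F \<and> circuit f (C i) \<and> l \<le> card (C i)" "disjoint_family_on C {..<j}"
        using pj unfolding packs_def by blast
      have "C i \<subseteq> E1 - F" if i: "i < j" for i
      proof -
        have "C i \<subseteq> E1" using C(1) i unfolding E1_def by blast
        then show ?thesis using C(1) i by blast
      qed
      then show ?thesis using C unfolding packs_def by blast
    qed
    then show ?thesis using F(3) packs_mono E1 by blast
  qed
  moreover have "card F \<le> 8 * L * (l - 1)" using F(2) Z(3) by (meson le_trans mult_le_mono1)
  ultimately show ?thesis using F(1) E1 by blast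
qed

text \<open>\<open>L\<close> stays fixed, since \<open>4 * k\<close> \<le> \<open>2 ^ L\<close>
  remains true as \<open>k\<close> decreases; hence each of the \<open>k\<close> rounds has the same
  price.\<close>

lemma long_circuit_erdos_posa:
  assumes "loopless f E" "2 \<le> l" "4 * k \<le> 2 ^ L"
  shows "packs f E l k \<or> (\<exists>F\<subseteq>E. card F \<le> k * (8 * L * (l - 1)) \<and> \<not> (\<exists>Z\<subseteq>E - F. circuit f Z \<and> l \<le> card Z))"
  using assms
proof (induction k arbitrary: E)
  case 0
  then show ?case by (auto simp: packs_def disjoint_family_on_def)
next
  case (Suc k)
  interpret loopless f E by (rule Suc.prems)
  show ?case
  proof (cases "packs f E l (Suc k)")
    case np: False
    show ?thesis
    proof (cases "\<exists>Z\<subseteq>E. circuit f Z \<and> l \<le> card Z")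
      case True
      then obtain D0 where D0: "D0 \<subseteq> E" "circuit f D0" "l \<le> card D0" by blast
      obtain F where F: "F \<subseteq> E" "card F \<le> 8 * L * (l - 1)" "\<And>j. packs f (E - F) l j \<Longrightarrow> packs f E l (Suc j)"
        using reduce_packing[OF _ Suc.prems(2,3) D0 np] by auto
      have "\<not> packs f (E - F) l k" using F(3) np by blast
      then obtain F' where F': "F' \<subseteq> E - F" "card F' \<le> k * (8 * L * (l - 1))"
        "\<not> (\<exists>Z\<subseteq>E - F - F'. circuit f Z \<and> l \<le> card Z)"
        using Suc.IH[of "E - F"] sub[of "E - F"] Suc.prems(2,3) by auto
      have "card (F \<union> F') \<le> Suc k * (8 * L * (l - 1))" using card_Un_le[of F F'] F(2) F'(2) by simp
      moreover have "E - (F \<union> F') = E - F - F'" by blast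
      ultimately show ?thesis using F F' by (intro disjI2 exI[of _ "F \<union> F'"]) auto
    next
      case False
      then show ?thesis by (intro disjI2 exI[of _ "{}"]) auto
    qed
  qed simp
qed

theorem theorem7:
  fixes G :: "('v, 'e) multigraph" and k l :: nat
  assumes "fin_multigraph G" and "2 \<le> l"
  shows "has_disjoint_long_cycles G k l \<or>
    (\<exists>F \<subseteq> edges G. int (card F) \<le> int k * g k l \<and>
       \<not> (\<exists>C. is_cycle (delete_edges G F) C \<and> l \<le> cycle_length C))"
proof (cases "k = 0")
  case True
  then show ?thesis by (auto simp: has_disjoint_long_cycles_def disjoint_family_on_def)
next
  case False
  interpret fin_multigraph G by fact
  \<comment> \<open>Loops lie on no cycle of length 2 or more and are dropped.\<close>
  define E where "E = {e \<in> edges G. card (ends G e) = 2}"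
  interpret loopless "ends G" E
    by unfold_locales (use finite_edges in \<open>auto simp: E_def\<close>)
  have tv: "touched (ends G) A \<subseteq> verts G" if A: "A \<subseteq> E" for A
  proof
    fix x assume "x \<in> touched (ends G) A"
    then obtain e where e: "e \<in> A" "x \<in> ends G e" by (auto simp: touched_def)
    then have "e \<in> edges G" using A by (auto simp: E_def)
    then show "x \<in> verts G" using ends_in_verts[of e] e(2) by auto
  qed
  \<comment> \<open>The added 1 gives \<open>2 * (k * l)\<close> \<le> \<open>2 ^ L\<close>, which
    covers the required \<open>4 * k\<close> since \<open>l\<close> is at least 2.\<close>
  define L where "L = nat (\<lceil>log 2 (real k * real l)\<rceil> + 1)"
  have "1 \<le> k * l" using False assms(2) by (simp add: Suc_le_eq)
  then have kl: "1 \<le> real k * real l" by (metis of_nat_1 of_nat_le_iff of_nat_mult)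
  have log0: "0 \<le> log 2 (real k * real l)" using kl by simp
  then have intL: "int L = \<lceil>log 2 (real k * real l)\<rceil> + 1" by (simp add: L_def)
  have "real k * real l = 2 powr log 2 (real k * real l)" using kl by simp
  also have "\<dots> \<le> 2 powr (real L - 1)"
  proof (rule powr_mono)
    have "log 2 (real k * real l) \<le> of_int \<lceil>log 2 (real k * real l)\<rceil>" by (rule le_of_int_ceiling)
    also have "\<dots> = real L - 1" using intL by (metis add_diff_cancel_right' of_int_1 of_int_diff of_int_of_nat_eq)
    finally show "log 2 (real k * real l) \<le> real L - 1" .
  qed simp
  also have "\<dots> = 2 ^ L / 2" by (simp add: powr_diff powr_realpow)
  finally have "2 * (real k * real l) \<le> 2 ^ L" by simp
  then have "real (2 * (k * l)) \<le> real (2 ^ L)" by simp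
  then have "2 * (k * l) \<le> 2 ^ L" by (simp only: of_nat_le_iff)
  moreover have "k * 2 \<le> k * l" using assms(2) by (rule mult_le_mono2)
  ultimately have L: "4 * k \<le> 2 ^ L" by linarith
  from long_circuit_erdos_posa[OF loopless_axioms assms(2) L] show ?thesis
  proof
    assume "packs (ends G) E l k"
    then obtain Z where Z: "\<forall>i<k. Z i \<subseteq> E \<and> circuit (ends G) (Z i) \<and> l \<le> card (Z i)" "disjoint_family_on Z {..<k}"
      unfolding packs_def by blast
    have "\<forall>i\<in>{..<k}. \<exists>C. is_cycle G C \<and> cycle_edges C = Z i"
    proof
      fix i assume "i \<in> {..<k}"
      then have Zi: "Z i \<subseteq> E" "circuit (ends G) (Z i)" using Z(1) by auto
      obtain vs es where C: "es \<noteq> []" "length vs = length es" "distinct vs" "set vs = touched (ends G) (Z i)" "distinct es"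
        "set es = Z i" "\<forall>j<length es. ends G (es ! j) = {vs ! j, vs ! (Suc j mod length es)}"
        using circuit_list[OF Zi] by blast
      have "is_cycle G (vs, es)" using C tv[OF Zi(1)] Zi(1) by (auto simp: is_cycle_def E_def)
      then show "\<exists>C. is_cycle G C \<and> cycle_edges C = Z i" using C(6) by (intro exI[of _ "(vs, es)"]) (simp add: cycle_edges_def)
    qed
    from bchoice[OF this] obtain C where C: "\<forall>i\<in>{..<k}. is_cycle G (C i) \<and> cycle_edges (C i) = Z i" ..
    have "\<forall>i<k. is_cycle G (C i) \<and> l \<le> cycle_length (C i)"
      using C Z(1) cycle_length_eq_card by (metis lessThan_iff)
    moreover have "disjoint_family_on (\<lambda>i. cycle_edges (C i)) {..<k}"
      using C Z(2) unfolding disjoint_family_on_def by simp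
    ultimately show ?thesis unfolding has_disjoint_long_cycles_def by blast
  next
    assume "\<exists>F\<subseteq>E. card F \<le> k * (8 * L * (l - 1)) \<and> \<not> (\<exists>Z\<subseteq>E - F. circuit (ends G) Z \<and> l \<le> card Z)"
    then obtain F where F: "F \<subseteq> E" "card F \<le> k * (8 * L * (l - 1))"
      "\<not> (\<exists>Z\<subseteq>E - F. circuit (ends G) Z \<and> l \<le> card Z)" by blast
    have "int (card F) \<le> int (k * (8 * L * (l - 1)))" using F(2) by (simp only: of_nat_le_iff)
    also have "\<dots> = int k * g k l" using False assms(2) by (simp add: g_def intL[symmetric] of_nat_diff)
    finally have "int (card F) \<le> int k * g k l" .
    moreover have "\<not> (is_cycle (delete_edges G F) C \<and> l \<le> cycle_length C)" for C
    proof
      assume C: "is_cycle (delete_edges G F) C \<and> l \<le> cycle_length C"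
      then have C2: "is_cycle (delete_edges G F) C" "2 \<le> cycle_length C" using assms(2) by auto
      have e: "ends (delete_edges G F) = ends G" by (simp add: delete_edges_def)
      have "cycle_edges C \<subseteq> edges G - F"
        using C2(1) by (auto simp: is_cycle_def cycle_edges_def delete_edges_def)
      then have "cycle_edges C \<subseteq> E - F" using cycle_imp_circuit(2)[OF C2] e by (auto simp: E_def)
      moreover have "circuit (ends G) (cycle_edges C)" using cycle_imp_circuit(1)[OF C2] e by simp
      moreover have "l \<le> card (cycle_edges C)" using C cycle_length_eq_card by metis
      ultimately show False using F(3) by blast
    qed
    moreover have "F \<subseteq> edges G" using F(1) by (auto simp: E_def)
    ultimately show ?thesis by blast
  qed
qed

end
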